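(* Let $X,X_1,X_2,\ldots$ be i.i.d. random vectors in $\mathbb{R}^d$ with density $f$, and let the kernel $K$, the density $f$, the weight function $\psi$, the number $\beta\in(0,1/2)$ and the functions $a,b,\lambda$ satisfy all the standing assumptions listed in the context. Assume additionally that $$\limsup_{t\to\infty} t\,\mathbb{P}\{\psi(X)>\lambda(t)\}<\infty .$$ Then $$\Delta_n:=\sup_{a_n\le h\le b_n}\sqrt{\frac{nh}{|\log h|}}\;\bigl\|\psi\,(f_{n,h}-\mathbb{E}f_{n,h})\bigr\|_\infty$$ is stochastically bounded, i.e. $\lim_{M\to\infty}\limsup_{n\to\infty}\mathbb{P}\{\Delta_n>M\}=0$.
   Context: Throughout, $|\cdot|$ denotes the sup-norm on $\mathbb{R}^d$ (and absolute value for real numbers). Data and estimator. $X,X_1,X_2,\ldots$ are i.i.d. $\mathbb{R}^d$-valued with a bounded Lebesgue density $f$. For $0<h<1$ and $t\in\mathbb{R}^d$, $$f_{n,h}(t)=\frac1{nh}\sum_{i=1}^nK\Bigl(\frac{X_i-t}{h^{1/d}}\Bigr).$$ Assumptions on the kernel. $K:\mathbb{R}^d\to[0,\infty)$ is measurable and compactly supported, with $\int_{\mathbb{R}^d}K(s)\,ds=1$ and $\|K\|_\infty:=\sup_x|K(x)|=\kappa<\infty$. Let $\mathcal{K}=\{K((\cdot-t)/h^{1/d}):h>0,\ t\in\mathbb{R}^d\}$. For a probability measure $Q$ on the Borel sets of $\mathbb{R}^d$, let $d_Q$ be the $L_2(Q)$-metric and $\mathcal{N}(\epsilon,\mathcal{K},d_Q)$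 the minimal number of balls $\{g:d_Q(g,g')<\epsilon\}$ needed to cover $\mathcal{K}$; put $\mathcal{N}(\epsilon,\mathcal{K})=\sup_Q\mathcal{N}(\kappa\epsilon,\mathcal{K},d_Q)$, the supremum being over all Borel probability measures $Q$. It is assumed that for some $C>0$, $\nu>0$: $\mathcal{N}(\epsilon,\mathcal{K})\le C\epsilon^{-\nu}$ for $0<\epsilon<1$. It is also assumed that $\mathcal{K}$ is pointwise measurable: there is a countable subclass $\mathcal{K}_0\subset\mathcal{K}$ such that for every $g\in\mathcal{K}$ there are $g_m\in\mathcal{K}_0$ with $g_m(z)\to g(z)$ for all $z\in\mathbb{R}^d$. Assumptions on the density. $B_f:=\{t:f(t)>0\}$ is open, and $f$ is bounded and continuous on $B_f$. For every $\delta>0$ there are $h_0>0$ and $0<c<\infty$ such that for all $x,x+y\in B_f$ with $|y|\le h_0$: $c^{-1}f^{1+\delta}(x)\le f(x+y)\le cf^{1-\delta}(x)$. For every $r>0$, with $F_r(h):=\{(x,y):x+y\in B_f,\ f(x)\ge h^r,\ |y|\le h\}$, one has $\lim_{h\to0}\sup_{(x,y)\in F_r(h)}|f(x+y)/f(x)-1|=0$. Assumptions on the weight function. $\psi:B_f\to(0,\infty)$ is continuous. For every $\delta>0$ there are $h_0>0$ and $0<c<\infty$ such that for all $x,x+y\in B_f$ with $|y|\le h_0$: $c^{-1}\psi^{1-\delta}(x)\le\psi(x+y)\le c\psi^{1+\delta}(x)$. For every $r>0$, with $G_r(h):=\{(x,y):x,x+y\in B_f,\ \psi(x)\le h^{-r},\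 |y|\le h\}$, one has $\lim_{h\to0}\sup_{(x,y)\in G_r(h)}|\psi(x+y)/\psi(x)-1|=0$. Joint assumptions. For the given $0<\beta<1/2$, $\|f^\beta\psi\|_\infty=\sup_{t\in B_f}|f^\beta(t)\psi(t)|<\infty$. For every $r>0$, $\lim_{h\to0}\sup_{(x,y)\in G_r(h)}|f(x+y)/f(x)-1|=0$. Bandwidth functions. $a_t=a(t)=t^{-\alpha}L_1(t)$ and $b_t=b(t)=t^{-\mu}L_2(t)$, $t>0$, are two decreasing functions, where $0<\mu<\alpha<1$ and $L_1,L_2$ are slowly varying at infinity. Put $\lambda(t):=\sqrt{ta_t|\log a_t|}$, $t>0$; it is assumed that $\lambda$ is strictly increasing on $(0,\infty)$. For functions involving $\psi$, which is defined only on $B_f$, $\|\cdot\|_\infty$ means the supremum over $t\in B_f$. The quantities are considered for $n$ large enough that $a_n\le b_n<1$. *)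

theory Defs
  imports "HOL-Probability.Probability"
begin

text \<open>
  The space of \<open>d\<close>-vectors is \<open>real ^ 'd\<close> with \<open>d = CARD('d)\<close>, and its sup-norm is the library's
  \<^const>\<open>infnorm\<close>.
\<close>

definition scaled_kernel ::
  "(real ^ 'd \<Rightarrow> real) \<Rightarrow> real \<Rightarrow> real ^ 'd \<Rightarrow> real ^ 'd \<Rightarrow> real"
  where "scaled_kernel K h t = (\<lambda>x. K ((x - t) /\<^sub>R (h powr (1 / real CARD('d)))))"

definition kernel_class :: "(real ^ 'd \<Rightarrow> real) \<Rightarrow> (real ^ 'd \<Rightarrow> real) set"
  where "kernel_class K = {scaled_kernel K h t | h t. 0 < h}"

definition L2_functions :: "'a measure \<Rightarrow> ('a \<Rightarrow> real) set"
  where "L2_functions Q = {g \<in> borel_measurable Q. integrable Q (\<lambda>x. (g x)\<^sup>2)}"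

definition L2_dist :: "'a measure \<Rightarrow> ('a \<Rightarrow> real) \<Rightarrow> ('a \<Rightarrow> real) \<Rightarrow> real"
  where "L2_dist Q g g' = sqrt (\<integral>x. (g x - g' x)\<^sup>2 \<partial>Q)"

text \<open>
  The centres of the balls range over all square-integrable functions, not only over the class
  being covered; the infimum is \<open>\<infinity>\<close> if there is no finite cover.
\<close>

definition covering_number :: "real \<Rightarrow> ('a \<Rightarrow> real) set \<Rightarrow> 'a measure \<Rightarrow> enat"
  where "covering_number \<epsilon> F Q =
    (INF C \<in> {C. finite C \<and> C \<subseteq> L2_functions Q \<and>
                 F \<subseteq> (\<Union>g'\<in>C. {g \<in> L2_functions Q. L2_dist Q g g' < \<epsilon>})}. enat (card C))"

definition uniform_covering_number ::
  "real \<Rightarrow> real \<Rightarrow> ('a::topological_space \<Rightarrow> real) set \<Rightarrow> enat"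
  where "uniform_covering_number \<kappa> \<epsilon> F =
    (SUP Q \<in> {Q. prob_space Q \<and> sets Q = sets borel}. covering_number (\<kappa> * \<epsilon>) F Q)"

definition pointwise_measurable :: "('a \<Rightarrow> real) set \<Rightarrow> bool"
  where "pointwise_measurable F \<longleftrightarrow>
    (\<exists>F0 \<subseteq> F. countable F0 \<and>
      (\<forall>g\<in>F. \<exists>G :: nat \<Rightarrow> 'a \<Rightarrow> real.
        (\<forall>m. G m \<in> F0) \<and> (\<forall>z. (\<lambda>m. G m z) \<longlonglongrightarrow> g z)))"

definition positivity_set :: "(real ^ 'd \<Rightarrow> real) \<Rightarrow> (real ^ 'd) set"
  where "positivity_set f = {t. 0 < f t}"

text \<open>
  In the next two sets \<open>h > 0\<close>, so \<open>f x \<ge> h powr r\<close> already forces \<open>x\<close> to lie in the positivity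
  set. Extended reals are used for the supremum below since it need not be finite for large \<open>h\<close>.
\<close>

definition F_set ::
  "(real ^ 'd \<Rightarrow> real) \<Rightarrow> real \<Rightarrow> real \<Rightarrow> ((real ^ 'd) \<times> (real ^ 'd)) set"
  where "F_set f r h =
    {(x, y). x + y \<in> positivity_set f \<and> f x \<ge> h powr r \<and> infnorm y \<le> h}"

definition G_set ::
  "(real ^ 'd \<Rightarrow> real) \<Rightarrow> (real ^ 'd \<Rightarrow> real) \<Rightarrow> real \<Rightarrow> real \<Rightarrow> ((real ^ 'd) \<times> (real ^ 'd)) set"
  where "G_set f \<psi> r h =
    {(x, y). x \<in> positivity_set f \<and> x + y \<in> positivity_set f \<and>
             \<psi> x \<le> h powr (- r) \<and> infnorm y \<le> h}"

definition vanishing_relative_oscillation ::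
  "(real ^ 'd \<Rightarrow> real) \<Rightarrow> (real \<Rightarrow> ((real ^ 'd) \<times> (real ^ 'd)) set) \<Rightarrow> bool"
  where "vanishing_relative_oscillation g S \<longleftrightarrow>
    ((\<lambda>h. SUP (x, y) \<in> S h. ereal \<bar>g (x + y) / g x - 1\<bar>) \<longlongrightarrow> 0) (at_right 0)"

definition slowly_varying :: "(real \<Rightarrow> real) \<Rightarrow> bool"
  where "slowly_varying L \<longleftrightarrow>
    (\<exists>A>0. set_borel_measurable borel {A<..} L \<and> (\<forall>t>A. L t > 0)) \<and>
    (\<forall>c>0. ((\<lambda>t. L (c * t) / L t) \<longlongrightarrow> 1) at_top)"

definition norming :: "(real \<Rightarrow> real) \<Rightarrow> real \<Rightarrow> real"
  where "norming a t = sqrt (t * a t * \<bar>ln (a t)\<bar>)"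

definition kernel_estimator ::
  "(real ^ 'd \<Rightarrow> real) \<Rightarrow> (nat \<Rightarrow> 'w \<Rightarrow> real ^ 'd) \<Rightarrow> nat \<Rightarrow> real \<Rightarrow> real ^ 'd \<Rightarrow> 'w \<Rightarrow> real"
  where "kernel_estimator K X n h t \<omega> =
    1 / (real n * h) * (\<Sum>i=1..n. scaled_kernel K h t (X i \<omega>))"

text \<open>
  The weighted deviation \<open>\<Delta>\<^sub>n\<close>. The weight only matters on the positivity set of the
  density \<open>f\<close>, over which the sup-norm is taken; the value may be infinite.
\<close>

definition weighted_deviation ::
  "'w measure \<Rightarrow> (nat \<Rightarrow> 'w \<Rightarrow> real ^ 'd) \<Rightarrow> (real ^ 'd \<Rightarrow> real) \<Rightarrow> (real ^ 'd \<Rightarrow> real) \<Rightarrow>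
   (real ^ 'd \<Rightarrow> real) \<Rightarrow> (real \<Rightarrow> real) \<Rightarrow> (real \<Rightarrow> real) \<Rightarrow> nat \<Rightarrow> 'w \<Rightarrow> ereal"
  where "weighted_deviation P X f K \<psi> a b n \<omega> =
    (SUP h \<in> {a (real n)..b (real n)}.
      ereal (sqrt (real n * h / \<bar>ln h\<bar>)) *
      (SUP t \<in> positivity_set f.
        ereal \<bar>\<psi> t * (kernel_estimator K X n h t \<omega>
                      - (\<integral>\<omega>'. kernel_estimator K X n h t \<omega>' \<partial>P))\<bar>))"

text \<open>
  A supremum over uncountably many \<open>h\<close> and \<open>t\<close> need not be measurable, and \<^const>\<open>measure\<close> vanishes
  on non-measurable sets, so tail probabilities are outer probabilities; these
  agree with ordinary probabilities on events.
\<close>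

definition stochastically_bounded :: "'w measure \<Rightarrow> (nat \<Rightarrow> 'w \<Rightarrow> ereal) \<Rightarrow> bool"
  where "stochastically_bounded P D \<longleftrightarrow>
    ((\<lambda>B::real. limsup (\<lambda>n. outer_measure_of P {\<omega> \<in> space P. D n \<omega> > ereal B})) \<longlongrightarrow> 0) at_top"

end

theory Submission
  imports Defs "HOL-Real_Asymp.Real_Asymp"
begin

text \<open>
  Write \<open>g\<close> for the scaled kernel with parameters \<open>h\<close> and \<open>t\<close>. Then the deviation at \<open>(h, t)\<close> equals
  \<open>w * \<bar>\<Sum>i. g (X i) - E\<bar>\<close> with \<open>w = \<psi> t / sqrt (n * h * \<bar>ln h\<bar>)\<close> and \<open>E = n * expectation g\<close>. All bandwidths
  under consideration lie between two negative powers of \<open>n\<close>, and \<open>n * h\<close> is at least a positive power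
  of \<open>n\<close>; hence \<open>\<bar>ln h\<bar>\<close> is comparable to \<open>ln n\<close>, and a union bound over polynomially many functions costs
  no more than the normalization allows. This makes chaining unnecessary and allows all \<open>h\<close> to be
  treated at once.

  Since \<open>f powr \<beta> * \<psi>\<close> is bounded with \<open>\<beta> < 1 / 2\<close>, and \<open>f\<close> is bounded on the window of \<open>t\<close> by a constant
  multiple of a power of \<open>f t\<close> with exponent arbitrarily close to one, \<open>w\<^sup>2 * ln n * E\<close> is bounded, while \<open>E\<close> is polynomially small as
  soon as \<open>w * ln n\<close> is not small (\<open>deviation_weights\<close>). Let \<open>M \<ge> 1\<close>.

  Where \<open>w\<close> is at least \<open>2 * sqrt M\<close>, there are no observations in the window, unless some
  \<open>\<psi> (X i)\<close> exceeds \<open>norming a (M * n)\<close> (\<open>no_observation_in_window\<close>); by the tail condition the latter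
  has probability at most of order \<open>1 / M\<close>. Without observations the deviation is \<open>w * E\<close>, which is
  bounded.

  Where \<open>w < 2 * sqrt M\<close>, a Bennett-type inequality for a single pair \<open>(w, g)\<close> gives probabilities
  smaller than any given power of \<open>1 / n\<close>, and it remains to reduce the supremum to polynomially many pairs
  (\<open>weighted_empirical_process_bound\<close>). To this end the sample is embedded into an array with
  \<open>n ^ 4\<close> i.i.d. columns (\<open>symmetrization\<close>). Conditionally on the array, the sample is a random selection
  of one entry per row; the class of kernels is covered in the \<open>L\<^sub>2\<close>-metric of the empirical measure of the
  array, and the exponential inequality is applied to the random selection. Pointwise measurability reduces
  the supremum to a countable one beforehand (\<open>countable_approximation\<close>).
\<close>

section \<open>Random selection from the rows of an array\<close>

lemma exp_le_chord:
  fixes c x \<kappa> :: real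
  assumes "0 < \<kappa>" "0 \<le> x" "x \<le> \<kappa>"
  shows "exp (c * x) \<le> 1 + x / \<kappa> * (exp (c * \<kappa>) - 1)"
proof -
  have "exp ((1 - x / \<kappa>) *\<^sub>R 0 + (x / \<kappa>) *\<^sub>R (c * \<kappa>)) \<le> (1 - x / \<kappa>) * exp 0 + (x / \<kappa>) * exp (c * \<kappa>)"
    by (rule convex_onD[OF exp_convex]) (use assms in \<open>auto simp: field_simps\<close>)
  then show ?thesis using assms by (simp add: algebra_simps)
qed

lemma exp_second_order_le:
  fixes y :: real
  shows "exp y - 1 - y \<le> y\<^sup>2 * exp \<bar>y\<bar> / 2"
proof -
  obtain t where t: "\<bar>t\<bar> \<le> \<bar>y\<bar>" "exp y = (\<Sum>m<2. y ^ m / fact m) + exp t / fact 2 * y ^ 2"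
    using Maclaurin_exp_le[of y 2] by blast
  have "exp y - 1 - y = exp t / 2 * y\<^sup>2" by (simp add: t(2) eval_nat_numeral)
  also have "\<dots> \<le> exp \<bar>y\<bar> / 2 * y\<^sup>2" using t(1) by (intro mult_right_mono) auto
  finally show ?thesis by (simp add: mult.commute)
qed

text \<open>
  One entry is selected independently and uniformly from each row of an array with \<open>m\<close> columns and
  entries in \<open>[0, \<kappa>]\<close>. Expectations are written as sums over all \<open>m ^ card I\<close> selections \<open>J\<close>; the mean of
  the selected sum is the sum of all entries divided by \<open>m\<close>.
\<close>

lemma selection_mgf:
  fixes x :: "'i \<Rightarrow> nat \<Rightarrow> real"
  assumes I: "finite I" and m: "0 < m" and \<kappa>: "0 < \<kappa>"
    and x: "\<And>i j. i \<in> I \<Longrightarrow> j < m \<Longrightarrow> 0 \<le> x i j \<and> x i j \<le> \<kappa>"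
  shows "(\<Sum>J\<in>PiE I (\<lambda>_. {..<m}). exp (c * (\<Sum>i\<in>I. x i (J i))))
    \<le> real m ^ card I * exp ((\<Sum>i\<in>I. \<Sum>j<m. x i j) / real m * ((exp (c * \<kappa>) - 1) / \<kappa>))"
proof -
  define e where "e = (exp (c * \<kappa>) - 1) / \<kappa>"
  have row: "(\<Sum>j<m. exp (c * x i j)) \<le> real m * exp ((\<Sum>j<m. x i j) / real m * e)" if i: "i \<in> I" for i
  proof -
    have "(\<Sum>j<m. exp (c * x i j)) \<le> (\<Sum>j<m. 1 + x i j * e)"
    proof (rule sum_mono)
      fix j assume "j \<in> {..<m}"
      then show "exp (c * x i j) \<le> 1 + x i j * e"
        using exp_le_chord[OF \<kappa>, of "x i j" c] x[OF i, of j] by (simp add: e_def)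
    qed
    also have "\<dots> = real m * (1 + (\<Sum>j<m. x i j) / real m * e)"
      using m by (simp add: sum.distrib sum_distrib_right[symmetric] distrib_left)
    also have "\<dots> \<le> real m * exp ((\<Sum>j<m. x i j) / real m * e)"
      by (intro mult_left_mono exp_ge_add_one_self) auto
    finally show ?thesis .
  qed
  have "(\<Sum>J\<in>PiE I (\<lambda>_. {..<m}). exp (c * (\<Sum>i\<in>I. x i (J i))))
      = (\<Prod>i\<in>I. \<Sum>j<m. exp (c * x i j))"
    using I by (simp add: prod_sum_PiE exp_sum sum_distrib_left)
  also have "\<dots> \<le> (\<Prod>i\<in>I. real m * exp ((\<Sum>j<m. x i j) / real m * e))"
    by (intro prod_mono conjI row sum_nonneg) auto
  also have "\<dots> = real m ^ card I * exp ((\<Sum>i\<in>I. \<Sum>j<m. x i j) / real m * e)"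
    using I by (simp add: prod.distrib exp_sum sum_divide_distrib sum_distrib_right)
  finally show ?thesis by (simp add: e_def)
qed

text \<open>
  The bound depends on the array only through the mean \<open>T\<close> of the selected sum. It is of Gaussian type
  except for the factor \<open>exp (s * w * \<kappa>)\<close>. For \<open>w\<close> of order one and \<open>s\<close> of order \<open>ln n\<close>, that factor is
  a power of \<open>n\<close>, which is harmless if \<open>T\<close> is polynomially small.
\<close>

lemma selection_tail:
  fixes x :: "'i \<Rightarrow> nat \<Rightarrow> real"
  assumes I: "finite I" and m: "0 < m" and \<kappa>: "0 < \<kappa>"
    and x: "\<And>i j. i \<in> I \<Longrightarrow> j < m \<Longrightarrow> 0 \<le> x i j \<and> x i j \<le> \<kappa>"
    and s: "0 \<le> s" and w: "0 \<le> w"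
  defines "T \<equiv> (\<Sum>i\<in>I. \<Sum>j<m. x i j) / real m"
  shows "real (card {J \<in> PiE I (\<lambda>_. {..<m}). u < w * \<bar>(\<Sum>i\<in>I. x i (J i)) - T\<bar>})
    \<le> real m ^ card I * (2 * exp (T / \<kappa> * ((s * w * \<kappa>)\<^sup>2 * exp (s * w * \<kappa>) / 2) - s * u))"
proof -
  let ?P = "PiE I (\<lambda>_. {..<m})"
  define S where "S J = (\<Sum>i\<in>I. x i (J i))" for J
  define y where "y = s * w * \<kappa>"
  have y: "0 \<le> y" using s w \<kappa> by (simp add: y_def)
  have T: "0 \<le> T" using x by (auto simp: T_def intro!: divide_nonneg_nonneg sum_nonneg)
  have fin: "finite ?P" using I by (simp add: finite_PiE)
  define V where "V = T / \<kappa> * (y\<^sup>2 * exp y / 2)"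
  have one: "(\<Sum>J\<in>?P. exp (\<sigma> * (s * w) * (S J - T) - s * u)) \<le> real m ^ card I * exp (V - s * u)"
    if \<sigma>: "\<bar>\<sigma>\<bar> = 1" for \<sigma> :: real
  proof -
    have "(\<Sum>J\<in>?P. exp (\<sigma> * (s * w) * (S J - T) - s * u))
        = exp (- \<sigma> * (s * w) * T - s * u) * (\<Sum>J\<in>?P. exp ((\<sigma> * (s * w)) * S J))"
      unfolding sum_distrib_left by (intro sum.cong refl) (simp add: exp_add[symmetric] algebra_simps)
    also have "\<dots> \<le> exp (- \<sigma> * (s * w) * T - s * u)
        * (real m ^ card I * exp (T * ((exp (\<sigma> * (s * w) * \<kappa>) - 1) / \<kappa>)))"
      unfolding S_def T_def by (intro mult_left_mono selection_mgf assms) auto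
    also have "\<dots> = real m ^ card I * exp (T / \<kappa> * (exp (\<sigma> * y) - 1 - \<sigma> * y) - s * u)"
      using \<kappa> by (simp add: exp_add[symmetric] y_def algebra_simps diff_divide_distrib)
    also have "\<dots> \<le> real m ^ card I * exp (V - s * u)"
    proof -
      have \<sigma>2: "\<sigma>\<^sup>2 = 1" using \<sigma> by (metis power2_abs power_one)
      have ay: "\<bar>\<sigma> * y\<bar> = y" using \<sigma> y by (simp add: abs_mult)
      have "exp (\<sigma> * y) - 1 - \<sigma> * y \<le> y\<^sup>2 * exp y / 2"
        using exp_second_order_le[of "\<sigma> * y"] unfolding ay by (simp add: power_mult_distrib \<sigma>2)
      then have "T / \<kappa> * (exp (\<sigma> * y) - 1 - \<sigma> * y) \<le> V"
        unfolding V_def using T \<kappa> by (intro mult_left_mono) auto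
      then show ?thesis by (intro mult_left_mono) auto
    qed
    finally show ?thesis .
  qed
  have "real (card {J \<in> ?P. u < w * \<bar>S J - T\<bar>})
      = (\<Sum>J\<in>?P. if u < w * \<bar>S J - T\<bar> then 1 else 0)"
    using fin by (simp add: sum.If_cases Int_def conj_commute)
  also have "\<dots> \<le> (\<Sum>J\<in>?P. exp (1 * (s * w) * (S J - T) - s * u) + exp (-1 * (s * w) * (S J - T) - s * u))"
  proof (rule sum_mono)
    fix J
    show "(if u < w * \<bar>S J - T\<bar> then 1 else 0)
        \<le> exp (1 * (s * w) * (S J - T) - s * u) + exp (-1 * (s * w) * (S J - T) - s * u)"
    proof (cases "u < w * \<bar>S J - T\<bar>")
      case True
      then have le: "s * u \<le> s * w * \<bar>S J - T\<bar>" using s by (simp add: mult_left_mono mult.assoc)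
      show ?thesis
      proof (cases "S J \<ge> T")
        case True
        then have "1 \<le> exp (1 * (s * w) * (S J - T) - s * u)" using le by simp
        then show ?thesis by (smt (verit) exp_ge_zero)
      next
        case False
        then have "1 \<le> exp (-1 * (s * w) * (S J - T) - s * u)" using le by (simp add: algebra_simps)
        then show ?thesis by (smt (verit) exp_ge_zero)
      qed
    qed (simp add: add_nonneg_nonneg)
  qed
  also have "\<dots> \<le> real m ^ card I * exp (V - s * u) + real m ^ card I * exp (V - s * u)"
    unfolding sum.distrib by (intro add_mono one) auto
  finally show ?thesis by (simp add: V_def y_def S_def)
qed

section \<open>Finite partitions from uniform entropy\<close>

lemma covering_number_attained:
  assumes "ereal_of_enat (covering_number \<epsilon> F Q) \<le> ereal B"
  obtains C where "finite C" "C \<subseteq> L2_functions Q" "real (card C) \<le> B"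
    "F \<subseteq> (\<Union>g'\<in>C. {g \<in> L2_functions Q. L2_dist Q g g' < \<epsilon>})"
proof -
  let ?S = "{C. finite C \<and> C \<subseteq> L2_functions Q \<and>
                 F \<subseteq> (\<Union>g'\<in>C. {g \<in> L2_functions Q. L2_dist Q g g' < \<epsilon>})}"
  have ne: "?S \<noteq> {}"
  proof
    assume "?S = {}"
    then have "covering_number \<epsilon> F Q = \<infinity>" unfolding covering_number_def by (simp only: image_empty Inf_enat_def) simp
    then show False using assms by simp
  qed
  have "covering_number \<epsilon> F Q \<in> (\<lambda>C. enat (card C)) ` ?S"
  proof -
    obtain C0 where "C0 \<in> ?S" using ne by blast
    then have "enat (card C0) \<in> (\<lambda>C. enat (card C)) ` ?S" by (rule imageI)
    then show ?thesis unfolding covering_number_def by (rule wellorder_InfI)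
  qed
  then obtain C where C: "C \<in> ?S" "covering_number \<epsilon> F Q = enat (card C)" by blast
  then show ?thesis using that[of C] assms by auto
qed

text \<open>
  The uniform covering number is applied to the uniform distribution on the points \<open>z i\<close>. Closeness
  in its \<open>L\<^sub>2\<close>-metric gives closeness at each single point, at the price of the factor
  \<open>sqrt (card I)\<close>; the covering radius will be polynomially small, so this loss does not matter.
\<close>

lemma entropy_partition:
  fixes F :: "('a::topological_space \<Rightarrow> real) set" and z :: "'i \<Rightarrow> 'a"
  assumes N: "ereal_of_enat (uniform_covering_number \<kappa> \<epsilon> F) \<le> ereal B"
    and \<kappa>\<epsilon>: "0 < \<kappa> * \<epsilon>" and I: "finite I" "I \<noteq> {}"
  shows "\<exists>c :: ('a \<Rightarrow> real) \<Rightarrow> ('a \<Rightarrow> real). finite (c ` F) \<and> real (card (c ` F)) \<le> B \<and>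
    (\<forall>g\<in>F. \<forall>g'\<in>F. c g = c g' \<longrightarrow>
      (\<forall>i\<in>I. \<bar>g (z i) - g' (z i)\<bar> \<le> 2 * (\<kappa> * \<epsilon>) * sqrt (real (card I))))"
proof -
  define Q where "Q = distr (measure_pmf (pmf_of_set I)) borel z"
  have Q: "prob_space Q" unfolding Q_def by (intro prob_space.prob_space_distr measure_pmf.prob_space_axioms) simp
  have sQ: "sets Q = sets borel" by (simp add: Q_def)
  have le: "covering_number (\<kappa> * \<epsilon>) F Q \<le> uniform_covering_number \<kappa> \<epsilon> F"
    unfolding uniform_covering_number_def by (rule SUP_upper) (use Q sQ in auto)
  have "ereal_of_enat (covering_number (\<kappa> * \<epsilon>) F Q) \<le> ereal B"
    using N le by (meson ereal_of_enat_le_iff order_trans)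
  from covering_number_attained[OF this] obtain C where C: "finite C" "C \<subseteq> L2_functions Q"
    "real (card C) \<le> B" "F \<subseteq> (\<Union>g'\<in>C. {g \<in> L2_functions Q. L2_dist Q g g' < \<kappa> * \<epsilon>})" by blast
  then have "\<forall>g\<in>F. \<exists>g'. g' \<in> C \<and> g \<in> L2_functions Q \<and> L2_dist Q g g' < \<kappa> * \<epsilon>" by blast
  then obtain c where c: "\<And>g. g \<in> F \<Longrightarrow> c g \<in> C \<and> g \<in> L2_functions Q \<and> L2_dist Q g (c g) < \<kappa> * \<epsilon>"
    by metis
  have point: "\<bar>g (z i) - c g (z i)\<bar> \<le> \<kappa> * \<epsilon> * sqrt (real (card I))" if g: "g \<in> F" and i: "i \<in> I" for g i
  proof -
    have [measurable]: "g \<in> borel_measurable borel" "c g \<in> borel_measurable borel"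
      using c[OF g] C(2) by (auto simp: L2_functions_def Q_def)
    define S where "S = (\<Sum>i\<in>I. (g (z i) - c g (z i))\<^sup>2)"
    have "(\<integral>x. (g x - c g x)\<^sup>2 \<partial>Q) = S / real (card I)"
      unfolding Q_def S_def using I by (simp add: integral_distr integral_pmf_of_set)
    then have "sqrt (S / real (card I)) < \<kappa> * \<epsilon>" using c[OF g] by (simp add: L2_dist_def)
    then have "sqrt S \<le> \<kappa> * \<epsilon> * sqrt (real (card I))"
      using I by (simp add: real_sqrt_divide field_simps card_gt_0_iff)
    moreover have "\<bar>g (z i) - c g (z i)\<bar> \<le> sqrt S"
    proof -
      have "(g (z i) - c g (z i))\<^sup>2 \<le> S" unfolding S_def using i I by (intro member_le_sum) auto
      then show ?thesis by (metis real_sqrt_abs real_sqrt_le_mono)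
    qed
    ultimately show ?thesis by simp
  qed
  show ?thesis
  proof (intro exI[of _ c] conjI ballI impI)
    have sub: "c ` F \<subseteq> C" using c by blast
    show "finite (c ` F)" using sub C(1) finite_subset by blast
    show "real (card (c ` F)) \<le> B" using card_mono[OF C(1) sub] C(3) by simp
  next
    fix g g' i assume "g \<in> F" "g' \<in> F" "c g = c g'" "i \<in> I"
    then show "\<bar>g (z i) - g' (z i)\<bar> \<le> 2 * (\<kappa> * \<epsilon>) * sqrt (real (card I))"
      using point[of g i] point[of g' i] by (auto simp: abs_le_iff)
  qed
qed

section \<open>Uniform bounds for random selections\<close>

text \<open>
  A union bound over the classes of a partition as above. Within a class the selected sums and their
  means nearly agree, but the weights may differ; so a class is represented by a pair whose weight
  is at least half the supremum of the weights in that class.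
\<close>

lemma uniform_selection_bound:
  fixes F :: "('a::topological_space \<Rightarrow> real) set" and z :: "'i \<times> nat \<Rightarrow> 'a"
    and G :: "(real \<times> ('a \<Rightarrow> real)) set"
  assumes I: "finite I" "I \<noteq> {}" and m: "0 < m" and \<kappa>: "0 < \<kappa>" and \<epsilon>: "0 < \<epsilon>"
    and F: "\<And>g x. g \<in> F \<Longrightarrow> 0 \<le> g x \<and> g x \<le> \<kappa>"
    and N: "ereal_of_enat (uniform_covering_number \<kappa> \<epsilon> F) \<le> ereal B"
    and G: "\<And>w g. (w, g) \<in> G \<Longrightarrow> g \<in> F \<and> 0 < w \<and> w \<le> A"
    and slack: "A * (4 * (real (card I) * (\<kappa> * \<epsilon>)) * sqrt (real (card I) * real m)) \<le> M / 2"
    and s: "0 \<le> s"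
  defines "T \<equiv> \<lambda>g. (\<Sum>i\<in>I. \<Sum>j<m. g (z (i, j))) / real m"
  assumes V: "\<And>w g. (w, g) \<in> G \<Longrightarrow> T g / \<kappa> * ((s * w * \<kappa>)\<^sup>2 * exp (s * w * \<kappa>) / 2) \<le> V"
  shows "real (card {J \<in> PiE I (\<lambda>_. {..<m}). \<exists>(w, g)\<in>G. M < w * \<bar>(\<Sum>i\<in>I. g (z (i, J i))) - T g\<bar>})
    \<le> B * (2 * exp (V - s * M / 4)) * real m ^ card I"
proof -
  let ?P = "PiE I (\<lambda>_. {..<m})"
  define D where "D J g = (\<Sum>i\<in>I. g (z (i, J i))) - T g" for J g
  define \<eta> where "\<eta> = 2 * (\<kappa> * \<epsilon>) * sqrt (real (card I) * real m)"
  have \<eta>_card: "\<eta> = 2 * (\<kappa> * \<epsilon>) * sqrt (real (card (I \<times> {..<m})))"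
    by (simp add: \<eta>_def card_cartesian_product)
  have fin: "finite ?P" using I by (simp add: finite_PiE)
  have ne: "I \<times> {..<m} \<noteq> {}" using I m by auto
  have k\<epsilon>: "0 < \<kappa> * \<epsilon>" using \<kappa> \<epsilon> by simp
  have \<eta>0: "0 \<le> \<eta>" using k\<epsilon> by (simp add: \<eta>_def less_imp_le)
  have finI: "finite (I \<times> {..<m})" using I by simp
  obtain c :: "_ \<Rightarrow> ('a \<Rightarrow> real)" where c: "finite (c ` F)" "real (card (c ` F)) \<le> B"
    and close: "\<And>g g' p. g \<in> F \<Longrightarrow> g' \<in> F \<Longrightarrow> c g = c g' \<Longrightarrow> p \<in> I \<times> {..<m} \<Longrightarrow> \<bar>g (z p) - g' (z p)\<bar> \<le> \<eta>"
    using entropy_partition[OF N k\<epsilon> finI ne, of z] unfolding \<eta>_card by blast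
  have D_close: "\<bar>D J g - D J g'\<bar> \<le> 2 * (real (card I) * \<eta>)"
    if "g \<in> F" "g' \<in> F" "c g = c g'" and J: "J \<in> ?P" for J g g'
  proof -
    have 1: "\<bar>(\<Sum>i\<in>I. g (z (i, J i))) - (\<Sum>i\<in>I. g' (z (i, J i)))\<bar> \<le> real (card I) * \<eta>"
    proof -
      have "\<bar>\<Sum>i\<in>I. g (z (i, J i)) - g' (z (i, J i))\<bar> \<le> (\<Sum>i\<in>I. \<eta>)"
        by (rule order_trans[OF sum_abs sum_mono])
           (use J in \<open>auto intro!: close that simp: PiE_def Pi_def\<close>)
      then show ?thesis by (simp add: sum_subtractf)
    qed
    have 2: "\<bar>T g - T g'\<bar> \<le> real (card I) * \<eta>"
    proof -
      have "\<bar>\<Sum>i\<in>I. \<Sum>j<m. g (z (i, j)) - g' (z (i, j))\<bar> \<le> (\<Sum>i\<in>I. \<Sum>j<m. \<eta>)"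
        by (intro order_trans[OF sum_abs sum_mono] order_trans[OF sum_abs sum_mono])
           (auto intro!: close that)
      then have "\<bar>(\<Sum>i\<in>I. \<Sum>j<m. g (z (i, j))) - (\<Sum>i\<in>I. \<Sum>j<m. g' (z (i, j)))\<bar> \<le> real m * (real (card I) * \<eta>)"
        by (simp add: sum_subtractf mult.left_commute)
      then show ?thesis unfolding T_def using m
        by (simp add: diff_divide_distrib[symmetric] field_simps)
    qed
    show ?thesis using 1 2 unfolding D_def by linarith
  qed
  define Gb where "Gb b = {p \<in> G. c (snd p) = b}" for b
  have rep: "\<exists>p\<in>Gb b. \<forall>q\<in>Gb b. fst q \<le> 2 * fst p" if neb: "Gb b \<noteq> {}" for b
  proof -
    let ?S = "fst ` Gb b"
    have bdd: "bdd_above ?S" using G by (auto simp: Gb_def bdd_above_def)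
    have neS: "?S \<noteq> {}" using neb by auto
    obtain p0 where p0: "p0 \<in> Gb b" using neb by auto
    have "0 < fst p0" using G p0 by (cases p0) (auto simp: Gb_def)
    also have "fst p0 \<le> Sup ?S" using bdd p0 by (intro cSup_upper) auto
    finally have "Sup ?S / 2 < Sup ?S" by simp
    then obtain p where p: "p \<in> Gb b" "Sup ?S / 2 < fst p"
      using less_cSup_iff[OF neS bdd] by auto
    have "fst q \<le> 2 * fst p" if "q \<in> Gb b" for q
      using cSup_upper[OF _ bdd, of "fst q"] that p(2) by auto
    then show ?thesis using p(1) by blast
  qed
  define r where "r b = (SOME p. p \<in> Gb b \<and> (\<forall>q\<in>Gb b. fst q \<le> 2 * fst p))" for b
  have r: "r b \<in> Gb b \<and> (\<forall>q\<in>Gb b. fst q \<le> 2 * fst (r b))" if "Gb b \<noteq> {}" for b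
    unfolding r_def by (rule someI_ex) (use rep[OF that] in blast)
  define Bs where "Bs = {b \<in> c ` F. Gb b \<noteq> {}}"
  define E where "E b = {J \<in> ?P. M / 4 < fst (r b) * \<bar>D J (snd (r b))\<bar>}" for b
  have sub: "{J \<in> ?P. \<exists>(w, g)\<in>G. M < w * \<bar>D J g\<bar>} \<subseteq> (\<Union>b\<in>Bs. E b)"
  proof
    fix J assume "J \<in> {J \<in> ?P. \<exists>(w, g)\<in>G. M < w * \<bar>D J g\<bar>}"
    then obtain w g where J: "J \<in> ?P" and wg: "(w, g) \<in> G" "M < w * \<bar>D J g\<bar>" by auto
    define b where "b = c g"
    have b: "(w, g) \<in> Gb b" using wg by (simp add: Gb_def b_def)
    obtain w' g' where rb: "r b = (w', g')" by (cases "r b")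
    have r': "(w', g') \<in> Gb b" "w \<le> 2 * w'" using r[of b] b rb by fastforce+
    have g: "g \<in> F" "g' \<in> F" "c g = c g'" "0 < w" "w \<le> A" "0 < w'"
      using G wg(1) r' b by (auto simp: Gb_def)
    have "w * \<bar>D J g\<bar> \<le> w * (\<bar>D J g'\<bar> + 2 * (real (card I) * \<eta>))"
      using D_close[OF g(1-3) J] g(4) by (intro mult_left_mono) linarith+
    also have "\<dots> = w * \<bar>D J g'\<bar> + w * (2 * (real (card I) * \<eta>))" by (simp add: distrib_left)
    also have "\<dots> \<le> 2 * w' * \<bar>D J g'\<bar> + A * (2 * (real (card I) * \<eta>))"
      using r'(2) g \<eta>0 by (intro add_mono mult_right_mono) auto
    also have "A * (2 * (real (card I) * \<eta>)) \<le> M / 2"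
      using slack by (simp add: \<eta>_def algebra_simps)
    finally have "M / 4 < w' * \<bar>D J g'\<bar>" using wg(2) by simp
    then have "J \<in> E b" using J by (simp add: E_def rb)
    moreover have "b \<in> Bs" using b g(1) by (auto simp: Bs_def b_def)
    ultimately show "J \<in> (\<Union>b\<in>Bs. E b)" by blast
  qed
  have Eb: "real (card (E b)) \<le> real m ^ card I * (2 * exp (V - s * M / 4))" if "b \<in> Bs" for b
  proof -
    obtain w' g' where rb: "r b = (w', g')" by (cases "r b")
    have G': "(w', g') \<in> G" using r[of b] that by (auto simp: Bs_def rb Gb_def)
    have "real (card (E b)) \<le> real m ^ card I *
        (2 * exp (T g' / \<kappa> * ((s * w' * \<kappa>)\<^sup>2 * exp (s * w' * \<kappa>) / 2) - s * (M / 4)))"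
      unfolding E_def rb fst_conv snd_conv D_def T_def
      by (rule selection_tail) (use I m \<kappa> s G[OF G'] F in auto)
    also have "\<dots> \<le> real m ^ card I * (2 * exp (V - s * M / 4))"
      using V[OF G'] by (intro mult_left_mono) auto
    finally show ?thesis .
  qed
  have finBs: "finite Bs" using c(1) by (simp add: Bs_def)
  have finE: "finite (\<Union>b\<in>Bs. E b)" using finBs fin by (auto simp: E_def)
  have "real (card {J \<in> ?P. \<exists>(w, g)\<in>G. M < w * \<bar>D J g\<bar>}) \<le> real (card (\<Union>b\<in>Bs. E b))"
    using card_mono[OF finE sub] by simp
  also have "\<dots> \<le> (\<Sum>b\<in>Bs. real (card (E b)))"
    using card_UN_le[OF finBs, of E] by (metis of_nat_le_iff of_nat_sum)
  also have "\<dots> \<le> (\<Sum>b\<in>Bs. real m ^ card I * (2 * exp (V - s * M / 4)))" by (intro sum_mono Eb)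
  also have "\<dots> = real (card Bs) * (real m ^ card I * (2 * exp (V - s * M / 4)))" by simp
  also have "\<dots> \<le> B * (real m ^ card I * (2 * exp (V - s * M / 4)))"
  proof (rule mult_right_mono)
    have "card Bs \<le> card (c ` F)" using c(1) by (intro card_mono) (auto simp: Bs_def)
    then show "real (card Bs) \<le> B" using c(2) by simp
  qed simp
  finally show ?thesis unfolding D_def by (simp add: mult_ac)
qed

section \<open>Symmetrization by an array of ghost samples\<close>

lemma indep_vars_PiM_components:
  assumes D: "prob_space D" and I: "I \<noteq> {}"
  shows "prob_space.indep_vars (PiM I (\<lambda>_. D)) (\<lambda>_. D) (\<lambda>i z. z i) I"
proof -
  interpret prob_space "PiM I (\<lambda>_. D)" by (rule prob_space_PiM) (rule D)
  have "distr (PiM I (\<lambda>_. D)) (PiM I (\<lambda>_. D)) (\<lambda>x. \<lambda>i\<in>I. x i) = PiM I (\<lambda>_. D)"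
    using distr_PiM_reindex[of I "\<lambda>_. D" id I] D by simp
  moreover have "distr (PiM I (\<lambda>_. D)) D (\<lambda>z. z i) = D" if "i \<in> I" for i
    using distr_PiM_component[of I "\<lambda>_. D" i] D that by simp
  ultimately show ?thesis
    by (subst indep_vars_iff_distr_eq_PiM'[OF I]) (auto intro!: PiM_cong)
qed

lemma sum_concentration:
  fixes g :: "'a \<Rightarrow> real"
  assumes D: "prob_space D" and I: "I \<noteq> {}" and g[measurable]: "g \<in> borel_measurable D"
    and \<kappa>: "0 < \<kappa>" "\<And>x. 0 \<le> g x \<and> g x \<le> \<kappa>"
    and K: "finite K" "K \<subseteq> I" and \<rho>: "0 < \<rho>" "real (card K) * \<kappa>\<^sup>2 \<le> \<rho>\<^sup>2"
  shows "1 / 2 \<le> measure (PiM I (\<lambda>_. D))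
    {z \<in> space (PiM I (\<lambda>_. D)). \<bar>(\<Sum>p\<in>K. g (z p)) - real (card K) * (\<integral>x. g x \<partial>D)\<bar> < \<rho>}"
proof -
  interpret prob_space "PiM I (\<lambda>_. D)" by (rule prob_space_PiM) (rule D)
  interpret D: prob_space D by (rule D)
  let ?\<mu> = "\<integral>x. g x \<partial>D"
  let ?Z = "PiM I (\<lambda>_. D)"
  have compD: "distr ?Z D (\<lambda>z. z p) = D" if "p \<in> I" for p
    using distr_PiM_component[of I "\<lambda>_. D" p] D that by simp
  have exp: "expectation (\<lambda>z. g (z p)) = ?\<mu>" if p: "p \<in> I" for p
    using integral_distr[of "\<lambda>z. z p" ?Z D g] p by (simp add: compD)
  have indep: "indep_vars (\<lambda>_. borel) (\<lambda>p z. g (z p)) K"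
    by (rule indep_vars_compose2[OF indep_vars_subset[OF indep_vars_PiM_components[OF D I] K(2)]]) simp
  interpret H: Hoeffding_ineq ?Z K "\<lambda>p z. g (z p)" "\<lambda>_. 0" "\<lambda>_. \<kappa>" "\<Sum>p\<in>K. expectation (\<lambda>z. g (z p))"
    by unfold_locales (use K indep \<kappa> in auto)
  have mu: "(\<Sum>p\<in>K. expectation (\<lambda>z. g (z p))) = real (card K) * ?\<mu>"
    using K exp by (subst sum.cong[OF refl exp]) auto
  have meas[measurable]: "(\<lambda>z. \<Sum>p\<in>K. g (z p)) \<in> borel_measurable ?Z"
    using K g by (intro borel_measurable_sum) (auto intro!: measurable_compose[OF measurable_component_singleton])
  let ?G = "{z \<in> space ?Z. \<bar>(\<Sum>p\<in>K. g (z p)) - real (card K) * ?\<mu>\<bar> < \<rho>}"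
  show ?thesis
  proof (cases "K = {}")
    case True
    then have "?G = space ?Z" using \<rho> by auto
    then show ?thesis by (simp add: prob_space)
  next
    case False
    let ?B = "{z \<in> space ?Z. \<bar>(\<Sum>p\<in>K. g (z p)) - real (card K) * ?\<mu>\<bar> \<ge> \<rho>}"
    have pos: "0 < (\<Sum>p\<in>K. (\<kappa> - 0)\<^sup>2)" using False K \<kappa> by (simp add: card_gt_0_iff)
    have "prob ?B \<le> 2 * exp (-2 * \<rho>\<^sup>2 / (\<Sum>p\<in>K. (\<kappa> - 0)\<^sup>2))"
      using H.Hoeffding_ineq_abs_ge[OF _ pos, of \<rho>] \<rho> by (simp add: mu)
    also have "\<dots> \<le> 2 * exp (-2)"
      using \<rho> pos by (simp add: field_simps)
    also have "\<dots> \<le> 1 / 2"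
    proof -
      have "(4::real) \<le> 2 ^ 2" by simp
      also have "(2::real) ^ 2 \<le> exp 1 ^ 2" by (intro power_mono) (use exp_ge_add_one_self[of 1] in auto)
      also have "\<dots> = exp 2" by (simp add: exp_of_nat_mult[symmetric])
      finally show ?thesis by (simp add: exp_minus field_simps)
    qed
    finally have "prob ?B \<le> 1 / 2" .
    moreover have "?G = space ?Z - ?B" by auto
    moreover have "?B \<in> sets ?Z" by measurable
    ultimately show ?thesis by (simp add: prob_compl)
  qed
qed

text \<open>
  The sample is column \<open>0\<close> of an array with \<open>m\<close> i.i.d. columns. For every fixed pair, the average of the
  sums over the remaining columns is within \<open>\<rho>\<close> of its expectation with probability at least \<open>1 / 2\<close>; then
  a large deviation of the sample sum from its expectation is also one from the average \<open>T\<close> over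
  all columns. As permuting the entries within the
  rows changes neither the law of the array nor \<open>T\<close>, the probability of the latter is that of
  a large deviation from \<open>T\<close> for a randomly selected entry in each row of a fixed array. In contrast to
  symmetrization with a single ghost sample (\<open>m = 2\<close>), the conditional variance is controlled by the
  expectations of the functions, hence no separate bound for it is needed.
\<close>

lemma symmetrization:
  fixes G :: "(real \<times> ('a \<Rightarrow> real)) set" and I :: "'i set"
  assumes D: "prob_space D" and I: "finite I" "I \<noteq> {}" and m: "0 < m" and G: "countable G"
    and \<kappa>: "0 < \<kappa>" and A: "0 \<le> A"
    and Gg: "\<And>w g x. (w, g) \<in> G \<Longrightarrow> g \<in> borel_measurable D \<and> 0 \<le> g x \<and> g x \<le> \<kappa> \<and> 0 < w \<and> w \<le> A"
    and \<rho>: "0 < \<rho>" "real (card I) * \<kappa>\<^sup>2 \<le> real m * \<rho>\<^sup>2"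
  defines "S \<equiv> \<lambda>z J g. \<Sum>i\<in>I. g (z (i, J i))"
    and "T \<equiv> \<lambda>z g. (\<Sum>i\<in>I. \<Sum>j<m. g (z (i, j))) / real m"
    and "\<mu> \<equiv> \<lambda>g. real (card I) * (\<integral>x. g x \<partial>D)"
    and "\<rho>' \<equiv> \<rho> + real (card I) * \<kappa> / real m"
  assumes sel: "\<And>z. real (card {J \<in> PiE I (\<lambda>_. {..<m}).
      \<exists>(w, g)\<in>G. \<bar>T z g - \<mu> g\<bar> \<le> \<rho>' \<and> M - A * \<rho>' < w * \<bar>S z J g - T z g\<bar>})
      \<le> q * real m ^ card I"
  shows "measure (PiM I (\<lambda>_. D)) {x \<in> space (PiM I (\<lambda>_. D)). \<exists>(w, g)\<in>G.
      M < w * \<bar>(\<Sum>i\<in>I. g (x i)) - \<mu> g\<bar>} \<le> 2 * q"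
proof -
  define K where "K = I \<times> {..<m}"
  define Z where "Z = PiM K (\<lambda>_. D)"
  define X where "X = PiM I (\<lambda>_. D)"
  let ?P = "PiE I (\<lambda>_. {..<m})"
  interpret Z: prob_space Z unfolding Z_def by (rule prob_space_PiM) (rule D)
  interpret D: prob_space D by (rule D)
  define H where "H J = {z \<in> space Z. \<exists>(w, g)\<in>G. \<bar>T z g - \<mu> g\<bar> \<le> \<rho>' \<and> M - A * \<rho>' < w * \<bar>S z J g - T z g\<bar>}" for J
  have K: "finite K" using I by (simp add: K_def)
  have Kne: "K \<noteq> {}" using I m by (auto simp: K_def)
  have gm[measurable]: "(\<lambda>z. g (z p)) \<in> borel_measurable Z" if "(w, g) \<in> G" "p \<in> K" for w g p
    unfolding Z_def using Gg[OF that(1)] that(2)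
    by (auto intro!: measurable_compose[OF measurable_component_singleton])
  have Sm[measurable]: "(\<lambda>z. S z J g) \<in> borel_measurable Z" if "(w, g) \<in> G" "J \<in> ?P" for w g J
    unfolding S_def using that by (auto intro!: borel_measurable_sum gm simp: K_def PiE_def Pi_def)
  have Tm[measurable]: "(\<lambda>z. T z g) \<in> borel_measurable Z" if "(w, g) \<in> G" for w g
    unfolding T_def using that by (auto intro!: borel_measurable_sum borel_measurable_divide gm simp: K_def)
  have Hm: "H J \<in> sets Z" if J: "J \<in> ?P" for J
  proof -
    have "H J = (\<Union>p\<in>G. {z \<in> space Z. \<bar>T z (snd p) - \<mu> (snd p)\<bar> \<le> \<rho>' \<and>
        M - A * \<rho>' < fst p * \<bar>S z J (snd p) - T z (snd p)\<bar>})"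
      unfolding H_def case_prod_beta by blast
    also have "\<dots> \<in> sets Z"
    proof (rule sets.countable_UN'[OF G], rule image_subsetI)
      fix p assume "p \<in> G"
      then obtain w g where p: "p = (w, g)" "(w, g) \<in> G" by (cases p) auto
      note [measurable] = Sm[OF p(2) J] Tm[OF p(2)]
      show "{z \<in> space Z. \<bar>T z (snd p) - \<mu> (snd p)\<bar> \<le> \<rho>' \<and>
        M - A * \<rho>' < fst p * \<bar>S z J (snd p) - T z (snd p)\<bar>} \<in> sets Z"
        unfolding p fst_conv snd_conv by measurable
    qed
    finally show ?thesis .
  qed
  define J0 :: "'i \<Rightarrow> nat" where "J0 = (\<lambda>i\<in>I. 0)"
  have J0: "J0 \<in> ?P" using m by (auto simp: J0_def)
  have swap: "Z.prob (H J) = Z.prob (H J0)" if J: "J \<in> ?P" for J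
  proof -
    \<comment> \<open>Exchange column \<open>0\<close> with the selected entry in each row.\<close>
    define \<pi> where "\<pi> = (\<lambda>(i, j). (i, Transposition.transpose 0 (J i) j))"
    have \<pi>K: "\<pi> \<in> K \<rightarrow> K" using J m by (auto simp: \<pi>_def K_def PiE_def Pi_def Transposition.transpose_def)
    have inj: "inj_on \<pi> K" unfolding \<pi>_def inj_on_def by (auto) (metis transpose_involutory)
    define \<phi> where "\<phi> z = (\<lambda>p\<in>K. z (\<pi> p))" for z :: "'i \<times> nat \<Rightarrow> 'a"
    have d: "distr Z Z \<phi> = Z"
      using distr_PiM_reindex[of K "\<lambda>_. D" \<pi> K, OF D inj \<pi>K] by (simp add: Z_def \<phi>_def[abs_def])
    have \<phi>m[measurable]: "\<phi> \<in> measurable Z Z"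
      unfolding Z_def \<phi>_def[abs_def] using \<pi>K
      by (intro measurable_restrict measurable_component_singleton) auto
    have S\<phi>: "S (\<phi> z) J0 g = S z J g" for z g
      unfolding S_def by (rule sum.cong) (use m in \<open>auto simp: \<phi>_def J0_def K_def \<pi>_def\<close>)
    have T\<phi>: "T (\<phi> z) g = T z g" for z g
    proof -
      have "(\<Sum>j<m. g (\<phi> z (i, j))) = (\<Sum>j<m. g (z (i, j)))" if i: "i \<in> I" for i
      proof -
        have "(\<Sum>j<m. g (\<phi> z (i, j))) = (\<Sum>j<m. g (z (i, Transposition.transpose 0 (J i) j)))"
          by (rule sum.cong) (use i in \<open>auto simp: \<phi>_def K_def \<pi>_def\<close>)
        also have "\<dots> = (\<Sum>j<m. g (z (i, j)))"
          by (rule sum.reindex_bij_witness[of _ "Transposition.transpose 0 (J i)" "Transposition.transpose 0 (J i)"])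
             (use J i m in \<open>auto simp: PiE_def Pi_def Transposition.transpose_def\<close>)
        finally show ?thesis .
      qed
      then show ?thesis unfolding T_def by (metis (no_types, lifting) sum.cong)
    qed
    have "\<phi> -` H J0 \<inter> space Z = H J"
      using measurable_space[OF \<phi>m] by (auto simp: H_def S\<phi> T\<phi>)
    then show ?thesis using measure_distr[OF \<phi>m, of "H J0"] Hm[OF J0] by (simp add: d)
  qed
  have finP: "finite ?P" using I by (simp add: finite_PiE)
  have cardP: "real (card ?P) = real m ^ card I" using I by (simp add: card_PiE)
  have "real m ^ card I * Z.prob (H J0) = (\<Sum>J\<in>?P. Z.prob (H J))"
    using swap by (simp add: cardP[symmetric])
  also have "\<dots> = (\<Sum>J\<in>?P. \<integral>z. indicator (H J) z \<partial>Z)"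
    using Hm by (intro sum.cong refl) (simp add: Int_absorb1 sets.sets_into_space)
  also have "\<dots> = (\<integral>z. (\<Sum>J\<in>?P. indicator (H J) z) \<partial>Z)"
    using Hm by (intro Bochner_Integration.integral_sum[symmetric]) (auto simp: Z.emeasure_eq_measure)
  also have "\<dots> \<le> (\<integral>z. q * real m ^ card I \<partial>Z)"
  proof (rule integral_mono)
    show "integrable Z (\<lambda>z. \<Sum>J\<in>?P. indicator (H J) z :: real)"
      using Hm by (intro Bochner_Integration.integrable_sum) (auto simp: Z.emeasure_eq_measure)
    fix z assume z: "z \<in> space Z"
    have "(\<Sum>J\<in>?P. indicator (H J) z :: real) = real (card {J \<in> ?P. z \<in> H J})"
      using finP by (simp add: indicator_def sum.If_cases Int_def)
    also have "\<dots> \<le> q * real m ^ card I" using sel[of z] z by (simp add: H_def)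
    finally show "(\<Sum>J\<in>?P. indicator (H J) z) \<le> q * real m ^ card I" .
  qed simp
  also have "\<dots> = q * real m ^ card I" by (simp add: Z.prob_space)
  finally have PH: "Z.prob (H J0) \<le> q" using m by (simp add: mult.commute)

  define idx where "idx = to_nat_on G"
  define W where "W p = {x \<in> space X. M < fst p * \<bar>(\<Sum>i\<in>I. snd p (x i)) - \<mu> (snd p)\<bar>}" for p
  \<comment> \<open>Exceedance for \<open>p\<close> but for no pair that is enumerated before \<open>p\<close>: these events are disjoint and
  determined by column \<open>0\<close>, so the ghost columns are independent of them.\<close>
  define W' where "W' p = W p - (\<Union>p'\<in>{p'\<in>G. idx p' < idx p}. W p')" for p
  have Wm: "W p \<in> sets X" if p: "p \<in> G" for p
  proof -
    obtain w g where p: "p = (w, g)" "(w, g) \<in> G" using p by (cases p) auto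
    have [measurable]: "(\<lambda>x. \<Sum>i\<in>I. g (x i)) \<in> borel_measurable X"
      unfolding X_def using Gg[OF p(2)]
      by (auto intro!: borel_measurable_sum measurable_compose[OF measurable_component_singleton])
    show ?thesis unfolding W_def p fst_conv snd_conv by measurable
  qed
  have W'm: "W' p \<in> sets X" if p: "p \<in> G" for p
    unfolding W'_def using G
    by (intro sets.Diff Wm p sets.countable_UN' image_subsetI) (auto intro: Wm countable_subset[of _ G])
  have W'disj: "disjoint_family_on W' G"
  unfolding disjoint_family_on_def
  proof (intro ballI impI)
    fix p p' assume pp: "p \<in> G" "p' \<in> G" "p \<noteq> p'"
    have "idx p \<noteq> idx p'" unfolding idx_def using to_nat_on_inj[OF G] pp by simp
    then have "idx p < idx p' \<or> idx p' < idx p" by linarith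
    then show "W' p \<inter> W' p' = {}" using pp unfolding W'_def by blast
  qed
  have W'un: "(\<Union>p\<in>G. W' p) = (\<Union>p\<in>G. W p)"
  proof
    show "(\<Union>p\<in>G. W p) \<subseteq> (\<Union>p\<in>G. W' p)"
    proof
      fix x assume "x \<in> (\<Union>p\<in>G. W p)"
      then obtain p0 where p0: "p0 \<in> G \<and> x \<in> W p0" by blast
      define p where "p = arg_min idx (\<lambda>p. p \<in> G \<and> x \<in> W p)"
      have "p \<in> G \<and> x \<in> W p" unfolding p_def by (rule arg_min_natI[of "\<lambda>p. p \<in> G \<and> x \<in> W p" p0]) (rule p0)
      moreover have "idx p \<le> idx p'" if "p' \<in> G \<and> x \<in> W p'" for p'
        unfolding p_def by (rule arg_min_nat_le[of "\<lambda>p. p \<in> G \<and> x \<in> W p"]) (rule that)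
      ultimately have "x \<in> W' p" unfolding W'_def by force
      then show "x \<in> (\<Union>p\<in>G. W' p)" using \<open>p \<in> G \<and> x \<in> W p\<close> by blast
    qed
  qed (auto simp: W'_def)

  define col where "col z = (\<lambda>i\<in>I. z (i, 0))" for z :: "'i \<times> nat \<Rightarrow> 'a"
  have cold: "distr Z X col = X"
    using distr_PiM_reindex[of K "\<lambda>_. D" "\<lambda>i. (i, 0)" I] D m
    by (auto simp: Z_def X_def col_def[abs_def] K_def inj_on_def)
  have colm[measurable]: "col \<in> measurable Z X"
    unfolding Z_def X_def col_def[abs_def] using m
    by (intro measurable_restrict measurable_component_singleton) (auto simp: K_def)
  \<comment> \<open>The ghost columns.\<close>
  define C1 where "C1 = I \<times> {1..<m}"
  have C1: "finite C1" "C1 \<subseteq> K" using I by (auto simp: C1_def K_def)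
  have cardC1: "card C1 = card I * (m - 1)" by (simp add: C1_def card_cartesian_product)
  define Y where "Y p = {z \<in> space Z. \<bar>(\<Sum>k\<in>C1. snd p (z k)) - real (card C1) * (\<integral>x. snd p x \<partial>D)\<bar> < real m * \<rho>}"
    for p :: "real \<times> ('a \<Rightarrow> real)"
  define V where "V p = col -` W' p \<inter> space Z" for p
  have Vm: "V p \<in> sets Z" if "p \<in> G" for p
    unfolding V_def using W'm[OF that] by measurable
  have half: "Z.prob (V p) / 2 \<le> Z.prob (V p \<inter> Y p)" and Ym: "Y p \<in> sets Z" if pG: "p \<in> G" for p
  proof -
    obtain w g where p: "p = (w, g)" "(w, g) \<in> G" using pG by (cases p) auto
    have g[measurable]: "g \<in> borel_measurable D" using Gg[OF p(2)] by simp
    have sm: "(\<lambda>y. \<Sum>k\<in>C1. g (y k)) \<in> borel_measurable (PiM C1 (\<lambda>_. D))"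
      using g by (auto intro!: borel_measurable_sum measurable_compose[OF measurable_component_singleton])
    have cm: "(\<lambda>y. \<lambda>i\<in>I. y (i, 0)) \<in> measurable (PiM (I \<times> {0 :: nat}) (\<lambda>_. D)) X"
      unfolding X_def by (intro measurable_restrict measurable_component_singleton) auto
    define c where "c = (\<lambda>(y :: 'i \<times> nat \<Rightarrow> 'a). \<lambda>i\<in>I. y (i, 0))"
    have ind: "Z.indep_var (PiM (I \<times> {0}) (\<lambda>_. D)) (\<lambda>z. restrict z (I \<times> {0}))
       (PiM C1 (\<lambda>_. D)) (\<lambda>z. restrict z C1)"
    proof -
      have "I \<times> {0} \<inter> C1 = {}" "I \<times> {0} \<subseteq> K" using m by (auto simp: C1_def K_def)
      from Z.indep_var_restrict[OF indep_vars_PiM_components[OF D Kne, folded Z_def] this C1(2)]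
      show ?thesis by simp
    qed
    have e1: "c (restrict z (I \<times> {0})) = col z" for z
      by (auto simp: c_def col_def fun_eq_iff restrict_def)
    have e2: "(\<Sum>k\<in>C1. g (restrict z C1 k)) = (\<Sum>k\<in>C1. g (z k))" for z
      by (rule sum.cong) auto
    define R where "R = {r :: real. \<bar>r - real (card C1) * (\<integral>x. g x \<partial>D)\<bar> < real m * \<rho>}"
    have R: "R \<in> sets borel" unfolding R_def by measurable
    have Yeq: "Y p = (\<lambda>z. \<Sum>k\<in>C1. g (z k)) -` R \<inter> space Z" by (auto simp: Y_def p R_def)
    define Xa where "Xa = c -` W' p \<inter> space (PiM (I \<times> {0}) (\<lambda>_. D))"
    define Xb where "Xb = (\<lambda>y. \<Sum>k\<in>C1. g (y k)) -` R \<inter> space (PiM C1 (\<lambda>_. D))"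
    have rs: "restrict z (I \<times> {0}) \<in> space (PiM (I \<times> {0}) (\<lambda>_. D))" "restrict z C1 \<in> space (PiM C1 (\<lambda>_. D))"
      if "z \<in> space Z" for z
      using that m by (auto simp: Z_def space_PiM K_def C1_def PiE_def Pi_def)
    have Veq: "V p = (\<lambda>z. restrict z (I \<times> {0})) -` Xa \<inter> space Z"
      unfolding V_def Xa_def using rs by (auto simp: e1)
    have Yeq': "Y p = (\<lambda>z. restrict z C1) -` Xb \<inter> space Z"
      unfolding Yeq Xb_def using rs by (auto simp: e2)
    have "Z.prob ((\<lambda>z. (restrict z (I \<times> {0}), restrict z C1)) -` (Xa \<times> Xb) \<inter> space Z)
        = Z.prob (V p) * Z.prob (Y p)"
      unfolding Veq Yeq' by (rule Z.indep_varD[OF ind])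
        (auto simp: Xa_def Xb_def c_def intro: measurable_sets[OF cm W'm[OF pG]] measurable_sets[OF sm R])
    also have "(\<lambda>z. (restrict z (I \<times> {0}), restrict z C1)) -` (Xa \<times> Xb) \<inter> space Z = V p \<inter> Y p"
      unfolding Veq Yeq' by auto
    finally have eq: "Z.prob (V p \<inter> Y p) = Z.prob (V p) * Z.prob (Y p)" .
    have "1 / 2 \<le> Z.prob (Y p)"
      unfolding Y_def p snd_conv Z_def
    proof (rule sum_concentration[OF D Kne g \<kappa> _ C1])
      show "0 \<le> g x \<and> g x \<le> \<kappa>" for x using Gg[OF p(2)] by simp
      show "0 < real m * \<rho>" using m \<rho> by simp
      have "real (card C1) * \<kappa>\<^sup>2 \<le> real m * (real (card I) * \<kappa>\<^sup>2)"
      proof -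
        have "real (card C1) \<le> real m * real (card I)"
          unfolding cardC1 of_nat_mult[symmetric] of_nat_le_iff by simp
        then show ?thesis using mult_right_mono[of "real (card C1)" "real m * real (card I)" "\<kappa>\<^sup>2"] by (simp add: mult.assoc)
      qed
      also have "\<dots> \<le> real m * (real m * \<rho>\<^sup>2)" using \<rho> by (intro mult_left_mono) auto
      finally show "real (card C1) * \<kappa>\<^sup>2 \<le> (real m * \<rho>)\<^sup>2" by (simp add: power2_eq_square mult_ac)
    qed
    then show "Z.prob (V p) / 2 \<le> Z.prob (V p \<inter> Y p)"
      unfolding eq using mult_left_mono[of "1/2" "Z.prob (Y p)" "Z.prob (V p)"] by simp
    have "(\<lambda>z. \<Sum>k\<in>C1. g (z k)) \<in> borel_measurable Z"
      using C1(2) by (intro borel_measurable_sum gm[OF p(2)]) auto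
    then show "Y p \<in> sets Z" unfolding Yeq using R by (rule measurable_sets)
  qed
  have incl: "V p \<inter> Y p \<subseteq> H J0" if pG: "p \<in> G" for p
  proof
    fix z assume z: "z \<in> V p \<inter> Y p"
    obtain w g where p: "p = (w, g)" "(w, g) \<in> G" using pG by (cases p) auto
    have g: "0 \<le> g x" "g x \<le> \<kappa>" "0 < w" "w \<le> A" for x using Gg[OF p(2)] by auto
    define U where "U = (\<Sum>k\<in>C1. g (z k))"
    have zs: "z \<in> space Z" using z by (simp add: V_def)
    have "col z \<in> W p" using z by (auto simp: V_def W'_def)
    moreover have S0: "(\<Sum>i\<in>I. g (col z i)) = S z J0 g" unfolding S_def by (rule sum.cong) (auto simp: col_def J0_def)
    ultimately have 1: "M < w * \<bar>S z J0 g - \<mu> g\<bar>" by (simp add: W_def p)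
    have 2: "\<bar>U - real (card C1) * (\<integral>x. g x \<partial>D)\<bar> < real m * \<rho>" using z by (simp add: Y_def p U_def)
    have T: "real m * T z g = S z J0 g + U"
    proof -
      have "(\<Sum>j<m. g (z (i, j))) = g (z (i, 0)) + (\<Sum>j\<in>{1..<m}. g (z (i, j)))" for i
        using sum.atLeast_Suc_lessThan[of 0 m "\<lambda>j. g (z (i, j))"] m by (simp add: lessThan_atLeast0)
      then have "real m * T z g = (\<Sum>i\<in>I. g (z (i, 0))) + (\<Sum>i\<in>I. \<Sum>j\<in>{1..<m}. g (z (i, j)))"
        using m by (simp add: T_def sum.distrib)
      also have "(\<Sum>i\<in>I. g (z (i, 0))) = S z J0 g" unfolding S_def by (rule sum.cong) (auto simp: J0_def)
      also have "(\<Sum>i\<in>I. \<Sum>j\<in>{1..<m}. g (z (i, j))) = U"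
        unfolding U_def C1_def using I by (simp add: sum.cartesian_product split_def)
      finally show ?thesis .
    qed
    have Eg: "0 \<le> (\<integral>x. g x \<partial>D)" "(\<integral>x. g x \<partial>D) \<le> \<kappa>"
    proof -
      show "0 \<le> (\<integral>x. g x \<partial>D)" using g by simp
      have "integrable D g" by (rule D.integrable_const_bound[of _ \<kappa>]) (use Gg[OF p(2)] in auto)
      then have "(\<integral>x. g x \<partial>D) \<le> (\<integral>x. \<kappa> \<partial>D)" using g by (intro integral_mono) auto
      then show "(\<integral>x. g x \<partial>D) \<le> \<kappa>" by (simp add: D.prob_space)
    qed
    have S01: "0 \<le> S z J0 g" "S z J0 g \<le> real (card I) * \<kappa>"
      unfolding S_def using g by (auto intro!: sum_nonneg sum_bounded_above)
    have \<mu>01: "0 \<le> \<mu> g" "\<mu> g \<le> real (card I) * \<kappa>"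
      unfolding \<mu>_def using Eg by (auto intro: mult_left_mono)
    have m\<mu>: "real m * \<mu> g = \<mu> g + real (card C1) * (\<integral>x. g x \<partial>D)"
      unfolding \<mu>_def cardC1 using m by (simp add: of_nat_diff algebra_simps)
    have "\<bar>real m * T z g - real m * \<mu> g\<bar> \<le> real m * \<rho> + real (card I) * \<kappa>"
      using T m\<mu> 2 S01 \<mu>01 by linarith
    also have "\<dots> = real m * \<rho>'" using m by (simp add: \<rho>'_def algebra_simps)
    finally have "real m * \<bar>T z g - \<mu> g\<bar> \<le> real m * \<rho>'"
      by (metis abs_mult abs_of_nat right_diff_distrib)
    then have T\<mu>: "\<bar>T z g - \<mu> g\<bar> \<le> \<rho>'" using m by simp
    have "w * \<bar>S z J0 g - \<mu> g\<bar> \<le> w * \<bar>S z J0 g - T z g\<bar> + w * \<bar>T z g - \<mu> g\<bar>"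
      using g(3) by (simp add: distrib_left[symmetric])
    also have "w * \<bar>T z g - \<mu> g\<bar> \<le> A * \<rho>'" using T\<mu> g(3,4) A by (intro mult_mono) auto
    finally have "M - A * \<rho>' < w * \<bar>S z J0 g - T z g\<bar>" using 1 by simp
    then show "z \<in> H J0" using zs p T\<mu> by (auto simp: H_def)
  qed
  have disjV: "disjoint_family_on (\<lambda>p. V p \<inter> Y p) G" "disjoint_family_on V G"
    using W'disj unfolding disjoint_family_on_def V_def by blast+
  have "emeasure X (\<Union>p\<in>G. W p) = emeasure Z (col -` (\<Union>p\<in>G. W' p) \<inter> space Z)"
  proof -
    have "(\<Union>p\<in>G. W' p) \<in> sets X" using W'm G by (intro sets.countable_UN' image_subsetI)
    then show ?thesis using emeasure_distr[OF colm, of "\<Union>p\<in>G. W' p"] by (simp add: cold W'un)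
  qed
  also have "col -` (\<Union>p\<in>G. W' p) \<inter> space Z = (\<Union>p\<in>G. V p)" by (auto simp: V_def)
  also have "emeasure Z (\<Union>p\<in>G. V p) = (\<integral>\<^sup>+p. emeasure Z (V p) \<partial>count_space G)"
    using Vm G disjV by (intro emeasure_UN_countable) auto
  also have "\<dots> \<le> (\<integral>\<^sup>+p. 2 * emeasure Z (V p \<inter> Y p) \<partial>count_space G)"
  proof (rule nn_integral_mono)
    fix p assume "p \<in> space (count_space G)"
    then have "Z.prob (V p) \<le> 2 * Z.prob (V p \<inter> Y p)" using half[of p] by simp
    then show "emeasure Z (V p) \<le> 2 * emeasure Z (V p \<inter> Y p)"
      by (simp add: Z.emeasure_eq_measure ennreal_mult'[symmetric] flip: ennreal_numeral)
  qed
  also have "\<dots> = 2 * emeasure Z (\<Union>p\<in>G. V p \<inter> Y p)"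
    using Vm Ym G disjV by (subst emeasure_UN_countable) (auto simp: nn_integral_cmult)
  also have "\<dots> \<le> 2 * emeasure Z (H J0)"
    using incl Hm[OF J0] by (intro mult_left_mono emeasure_mono) auto
  also have "\<dots> \<le> ennreal (2 * q)"
    using PH by (auto simp: Z.emeasure_eq_measure ennreal_mult'[symmetric] intro!: ennreal_leI simp flip: ennreal_numeral)
  finally have le: "emeasure X (\<Union>p\<in>G. W p) \<le> ennreal (2 * q)" .
  have q: "0 \<le> q" using PH measure_nonneg[of Z "H J0"] by linarith
  have "{x \<in> space X. \<exists>(w, g)\<in>G. M < w * \<bar>(\<Sum>i\<in>I. g (x i)) - \<mu> g\<bar>} = (\<Union>p\<in>G. W p)"
    unfolding W_def case_prod_beta by blast
  moreover have "measure X (\<Union>p\<in>G. W p) \<le> 2 * q"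
    using le q unfolding measure_def by (simp add: enn2real_leI)
  ultimately show ?thesis unfolding X_def by simp
qed

section \<open>A bound for weighted empirical processes\<close>

text \<open>
  The exponent of \<open>selection_tail\<close> at \<open>s = \<tau> * ln n\<close> is at most a constant multiple of \<open>ln n\<close>. If
  \<open>w * ln n \<le> 1\<close>, then the exponential factor is bounded and the bound on \<open>w\<^sup>2 * ln n * \<mu>\<close> suffices;
  otherwise \<open>\<tau>\<close> is so small that the exponential factor is outweighed by \<open>\<mu> \<le> A * n powr - c\<close>.
\<close>

lemma chernoff_exponent_bound:
  fixes n \<kappa> A c w \<mu> T L \<tau> :: real
  assumes \<kappa>: "0 < \<kappa>" and A: "0 < A" and c: "0 < c" "c \<le> 1" and n: "0 < n" and L: "L = ln n" "1 \<le> L"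
    and w: "0 < w" "w \<le> A" and \<mu>: "w\<^sup>2 * L * \<mu> \<le> A" "1 < w * L \<Longrightarrow> \<mu> \<le> A * n powr - c"
    and T: "0 \<le> T" "T \<le> \<mu> + (1 + \<kappa>) / n" and \<tau>: "\<tau> = c / (2 * \<kappa> * A)"
  shows "T / \<kappa> * ((\<tau> * L * w * \<kappa>)\<^sup>2 * exp (\<tau> * L * w * \<kappa>) / 2)
    \<le> (\<tau>\<^sup>2 * \<kappa> * exp (\<tau> * \<kappa>) * (A + 1 + \<kappa>) / 2 + (A + 1 + \<kappa>) / \<kappa>) * L"
proof -
  define y where "y = \<tau> * L * w * \<kappa>"
  have \<tau>0: "0 < \<tau>" using c \<kappa> A by (simp add: \<tau>)
  have y0: "0 \<le> y" using \<tau>0 L w \<kappa> by (simp add: y_def)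
  have n1: "1 \<le> n" using L n by (smt (verit) ln_le_zero_iff)
  have first: "0 \<le> \<tau>\<^sup>2 * \<kappa> * exp (\<tau> * \<kappa>) * (A + 1 + \<kappa>) / 2 * L" using \<kappa> A L by simp
  have second: "0 \<le> (A + 1 + \<kappa>) / \<kappa> * L" using \<kappa> A L by simp
  show ?thesis
  proof (cases "w * L \<le> 1")
    case True
    have w1: "w \<le> 1" using True L(2) w(1) by (smt (verit) mult_le_cancel_left1)
    have wL: "w\<^sup>2 * L \<le> 1" using mult_mono[OF w1 True] w L by (simp add: power2_eq_square mult_ac)
    have "w\<^sup>2 * L * T \<le> w\<^sup>2 * L * (\<mu> + (1 + \<kappa>) / n)" using T L by (intro mult_left_mono) auto
    also have "\<dots> = w\<^sup>2 * L * \<mu> + w\<^sup>2 * L * ((1 + \<kappa>) / n)" by (simp add: distrib_left)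
    also have "\<dots> \<le> A + 1 * ((1 + \<kappa>) / 1)"
      using \<mu>(1) wL \<kappa> n1 L by (intro add_mono mult_mono divide_left_mono) auto
    finally have wLT: "w\<^sup>2 * L * T \<le> A + 1 + \<kappa>" by simp
    have "y \<le> \<tau> * \<kappa>" using mult_left_mono[OF True, of "\<tau> * \<kappa>"] \<tau>0 \<kappa> by (simp add: y_def mult_ac)
    then have ey: "exp y \<le> exp (\<tau> * \<kappa>)" by simp
    have "T / \<kappa> * (y\<^sup>2 * exp y / 2) = \<tau>\<^sup>2 * \<kappa> * L / 2 * (w\<^sup>2 * L * T) * exp y"
      using \<kappa> by (simp add: y_def power2_eq_square)
    also have "\<dots> \<le> \<tau>\<^sup>2 * \<kappa> * L / 2 * (A + 1 + \<kappa>) * exp (\<tau> * \<kappa>)"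
      using wLT ey \<kappa> A L T by (intro mult_mono) auto
    also have "\<dots> = \<tau>\<^sup>2 * \<kappa> * exp (\<tau> * \<kappa>) * (A + 1 + \<kappa>) / 2 * L" by simp
    finally show ?thesis using second unfolding y_def[symmetric] distrib_right by linarith
  next
    case False
    have "y \<le> \<tau> * L * A * \<kappa>" using w \<tau>0 L \<kappa> unfolding y_def by (intro mult_mono) auto
    also have "\<dots> = c / 2 * L" using \<kappa> A by (simp add: \<tau>)
    finally have yc: "2 * y \<le> c * L" by simp
    have "y\<^sup>2 / 2 \<le> exp y"
    proof -
      have "1 + y + y\<^sup>2 / 2 \<le> exp y" using exp_lower_Taylor_quadratic[OF y0] by simp
      then show ?thesis using y0 by linarith
    qed
    then have "y\<^sup>2 * exp y / 2 \<le> exp y * exp y" using mult_right_mono[of "y\<^sup>2 / 2" "exp y" "exp y"] by simp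
    also have "\<dots> = exp (2 * y)" by (simp add: exp_add[symmetric])
    also have "\<dots> \<le> n powr c" using yc n L by (simp add: powr_def)
    finally have e: "y\<^sup>2 * exp y / 2 \<le> n powr c" .
    have "T \<le> A * n powr - c + (1 + \<kappa>) * n powr - 1"
      using T \<mu>(2) False n by (simp add: powr_minus divide_inverse)
    also have "\<dots> \<le> A * n powr - c + (1 + \<kappa>) * n powr - c"
      using n1 c \<kappa> by (intro add_left_mono mult_left_mono powr_mono) auto
    finally have T': "T \<le> (A + 1 + \<kappa>) * n powr - c" by (simp add: algebra_simps)
    have "T / \<kappa> * (y\<^sup>2 * exp y / 2) \<le> (A + 1 + \<kappa>) * n powr - c / \<kappa> * n powr c"
      using T' e \<kappa> T A by (intro mult_mono divide_right_mono) auto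
    also have "\<dots> = (A + 1 + \<kappa>) / \<kappa> * (n powr - c * n powr c)" by simp
    also have "\<dots> = (A + 1 + \<kappa>) / \<kappa>" using n by (simp add: powr_add[symmetric])
    also have "\<dots> \<le> (A + 1 + \<kappa>) / \<kappa> * L" using mult_left_mono[OF L(2), of "(A + 1 + \<kappa>) / \<kappa>"] \<kappa> A by simp
    finally show ?thesis using first unfolding y_def[symmetric] distrib_right by linarith
  qed
qed

text \<open>
  In-probability bound for weighted empirical processes indexed by pairs of a weight \<open>w\<close> and a
  function \<open>g\<close>. It combines \<open>symmetrization\<close> with \<open>m = n ^ 4\<close> columns and \<open>uniform_selection_bound\<close>
  with covering radius of order \<open>n powr - 5\<close>: only polynomially many classes occur, and each of them
  contributes at most an arbitrarily high power of \<open>1 / n\<close> if \<open>M\<close> is large enough.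
\<close>

theorem weighted_empirical_process_bound:
  fixes F :: "('a::topological_space \<Rightarrow> real) set" and G :: "nat \<Rightarrow> (real \<times> ('a \<Rightarrow> real)) set"
  assumes D: "prob_space D" "sets D = sets borel" and \<kappa>: "0 < \<kappa>"
    and F: "\<And>g x. g \<in> F \<Longrightarrow> g \<in> borel_measurable borel \<and> 0 \<le> g x \<and> g x \<le> \<kappa>"
    and N: "\<And>\<epsilon>. 0 < \<epsilon> \<Longrightarrow> \<epsilon> < 1 \<Longrightarrow>
      ereal_of_enat (uniform_covering_number \<kappa> \<epsilon> F) \<le> ereal (C * \<epsilon> powr - \<nu>)"
    and C: "0 < C" "0 < \<nu>" and A: "0 < A" and c: "0 < c" "c \<le> 1"
    and countG: "\<And>n. countable (G n)"
    and G: "\<And>n w g. (w, g) \<in> G n \<Longrightarrow> g \<in> F \<and> 0 < w \<and> w \<le> A \<and>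
      w\<^sup>2 * ln (real n) * (real n * (\<integral>x. g x \<partial>D)) \<le> A \<and>
      (1 < w * ln (real n) \<longrightarrow> real n * (\<integral>x. g x \<partial>D) \<le> A * real n powr - c)"
  shows "\<exists>M. (\<lambda>n. measure (PiM {1..n} (\<lambda>_. D)) {x \<in> space (PiM {1..n} (\<lambda>_. D)). \<exists>(w, g)\<in>G n.
      M < w * \<bar>(\<Sum>i=1..n. g (x i)) - real n * (\<integral>x. g x \<partial>D)\<bar>}) \<longlonglongrightarrow> 0"
proof -
  define \<tau> where "\<tau> = c / (2 * \<kappa> * A)"
  define C1 where "C1 = \<tau>\<^sup>2 * \<kappa> * exp (\<tau> * \<kappa>) * (A + 1 + \<kappa>) / 2 + (A + 1 + \<kappa>) / \<kappa>"
  \<comment> \<open>The choice of \<open>M\<close> makes the total exponent in \<open>q\<close> below at most \<open>- ln n\<close>.\<close>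
  define M where "M = 1 + 8 * (5 * \<nu> + C1 + 1) / \<tau>"
  define p where "p n = measure (PiM {1..n} (\<lambda>_. D)) {x \<in> space (PiM {1..n} (\<lambda>_. D)). \<exists>(w, g)\<in>G n.
      M < w * \<bar>(\<Sum>i=1..n. g (x i)) - real n * (\<integral>x. g x \<partial>D)\<bar>}" for n
  have \<tau>0: "0 < \<tau>" using c \<kappa> A by (simp add: \<tau>_def)
  have C10: "0 \<le> C1" using \<kappa> A by (simp add: C1_def)
  have M1: "1 \<le> M" using \<tau>0 C10 C by (simp add: M_def)
  have bound: "p n \<le> 4 * C / real n"
    if n: "2 \<le> n" "1 \<le> ln (real n)" "\<kappa>\<^sup>2 \<le> real n" "2 * (A * (1 + \<kappa>)) \<le> real n" "16 * (A * \<kappa>) \<le> real n" for n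
  proof -
    define m where "m = n ^ 4"
    define L where "L = ln (real n)"
    define \<rho> where "\<rho> = 1 / real n"
    define \<rho>' where "\<rho>' = \<rho> + real n * \<kappa> / real m"
    define \<epsilon> where "\<epsilon> = 1 / real n ^ 5"
    define q where "q = C * exp (5 * \<nu> * L) * (2 * exp (C1 * L - \<tau> * L * (M - A * \<rho>') / 4))"
    have n0: "0 < real n" "1 < real n" using n by auto
    have m0: "0 < m" using n by (simp add: m_def)
    have \<rho>'0: "0 \<le> \<rho>'" using \<kappa> by (simp add: \<rho>'_def \<rho>_def)
    have \<rho>'le: "\<rho>' \<le> (1 + \<kappa>) / real n"
    proof -
      have "real n * \<kappa> / real m = \<kappa> / real n ^ 3" using n0 by (simp add: m_def eval_nat_numeral)
      also have "\<dots> \<le> \<kappa> / real n ^ 1" using n0 \<kappa> by (intro divide_left_mono power_increasing) auto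
      finally show ?thesis by (simp add: \<rho>'_def \<rho>_def add_divide_distrib)
    qed
    have A\<rho>: "A * \<rho>' \<le> M / 2"
    proof -
      have "A * \<rho>' \<le> A * ((1 + \<kappa>) / real n)" using \<rho>'le A by (intro mult_left_mono) auto
      also have "\<dots> \<le> 1 / 2" using n(4) n0 by (simp add: field_simps)
      finally show ?thesis using M1 by simp
    qed
    have \<epsilon>: "0 < \<epsilon>" "\<epsilon> < 1" using n0 by (auto simp: \<epsilon>_def)
    have slack: "A * (4 * (real (card {1..n}) * (\<kappa> * \<epsilon>)) * sqrt (real (card {1..n}) * real m)) \<le> (M - A * \<rho>') / 2"
    proof -
      have "real n * real n ^ 4 \<le> (real n ^ 3)\<^sup>2"
        using power_increasing[of 5 6 "real n"] n0 by (simp add: eval_nat_numeral)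
      then have "sqrt (real n * real m) \<le> real n ^ 3"
        by (intro real_le_lsqrt) (auto simp: m_def)
      then have "A * (4 * (real n * (\<kappa> * \<epsilon>)) * sqrt (real n * real m)) \<le> A * (4 * (real n * (\<kappa> * \<epsilon>)) * real n ^ 3)"
        using A \<kappa> \<epsilon> by (intro mult_left_mono) auto
      also have "\<dots> = 4 * (A * \<kappa>) / real n" using n0 by (simp add: \<epsilon>_def eval_nat_numeral)
      also have "\<dots> \<le> 1 / 4" using n(5) n0 by (simp add: field_simps)
      also have "\<dots> \<le> (M - A * \<rho>') / 2" using A\<rho> M1 by simp
      finally show ?thesis by simp
    qed
    have powr\<epsilon>: "C * \<epsilon> powr - \<nu> = C * exp (5 * \<nu> * L)"
      using n0 by (simp add: \<epsilon>_def L_def powr_def ln_div ln_realpow)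
    have "measure (PiM {1..n} (\<lambda>_. D)) {x \<in> space (PiM {1..n} (\<lambda>_. D)). \<exists>(w, g)\<in>G n.
      M < w * \<bar>(\<Sum>i=1..n. g (x i)) - real (card {1..n}) * (\<integral>x. g x \<partial>D)\<bar>} \<le> 2 * q"
    proof (rule symmetrization[where A = A and \<kappa> = \<kappa> and m = m and \<rho> = \<rho> and I = "{1..n}"])
      fix z :: "nat \<times> nat \<Rightarrow> 'a"
      define T where "T g = (\<Sum>i\<in>{1..n}. \<Sum>j<m. g (z (i, j))) / real m" for g :: "'a \<Rightarrow> real"
      define Gz where "Gz = {(w, g). (w, g) \<in> G n \<and> \<bar>T g - real n * (\<integral>x. g x \<partial>D)\<bar> \<le> \<rho>'}"
      have "real (card {J \<in> PiE {1..n} (\<lambda>_. {..<m}). \<exists>(w, g)\<in>Gz. M - A * \<rho>' < w * \<bar>(\<Sum>i\<in>{1..n}. g (z (i, J i))) - T g\<bar>})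
          \<le> C * exp (5 * \<nu> * L) * (2 * exp (C1 * L - \<tau> * L * (M - A * \<rho>') / 4)) * real m ^ card {1..n}"
        unfolding T_def
      proof (rule uniform_selection_bound[where F = F and \<kappa> = \<kappa> and \<epsilon> = \<epsilon> and A = A])
        show "ereal_of_enat (uniform_covering_number \<kappa> \<epsilon> F) \<le> ereal (C * exp (5 * \<nu> * L))"
          using N[OF \<epsilon>] by (simp add: powr\<epsilon>)
        show "g \<in> F \<and> 0 < w \<and> w \<le> A" if "(w, g) \<in> Gz" for w g using G that by (auto simp: Gz_def)
        show "(\<Sum>i\<in>{1..n}. \<Sum>j<m. g (z (i, j))) / real m / \<kappa> *
            ((\<tau> * L * w * \<kappa>)\<^sup>2 * exp (\<tau> * L * w * \<kappa>) / 2) \<le> C1 * L" if wg: "(w, g) \<in> Gz" for w g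
          unfolding C1_def T_def[symmetric]
        proof (rule chernoff_exponent_bound[OF \<kappa> A c n0(1) L_def])
          have wgn: "(w, g) \<in> G n" and Tg: "\<bar>T g - real n * (\<integral>x. g x \<partial>D)\<bar> \<le> \<rho>'"
            using wg by (auto simp: Gz_def)
          note G' = G[OF wgn, folded L_def]
          show "0 < w" "w \<le> A" "w\<^sup>2 * L * (real n * (\<integral>x. g x \<partial>D)) \<le> A"
            "1 < w * L \<Longrightarrow> real n * (\<integral>x. g x \<partial>D) \<le> A * real n powr - c" using G' by auto
          show "0 \<le> T g" unfolding T_def using F G' by (auto intro!: divide_nonneg_nonneg sum_nonneg)
          show "T g \<le> real n * (\<integral>x. g x \<partial>D) + (1 + \<kappa>) / real n" using Tg \<rho>'le by linarith
        qed (use n in \<open>auto simp: L_def \<tau>_def\<close>)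
      qed (use n m0 \<kappa> \<epsilon> F slack \<tau>0 in \<open>auto simp: L_def\<close>)
      also have "{J \<in> PiE {1..n} (\<lambda>_. {..<m}). \<exists>(w, g)\<in>Gz. M - A * \<rho>' < w * \<bar>(\<Sum>i\<in>{1..n}. g (z (i, J i))) - T g\<bar>}
        = {J \<in> PiE {1..n} (\<lambda>_. {..<m}). \<exists>(w, g)\<in>G n. \<bar>T g - real n * (\<integral>x. g x \<partial>D)\<bar> \<le> \<rho>' \<and>
            M - A * \<rho>' < w * \<bar>(\<Sum>i\<in>{1..n}. g (z (i, J i))) - T g\<bar>}"
        unfolding Gz_def by blast
      finally show "real (card {J \<in> {1..n} \<rightarrow>\<^sub>E {..<m}.
          \<exists>(w, g)\<in>G n. \<bar>(\<Sum>i = 1..n. \<Sum>j<m. g (z (i, j))) / real m - real (card {1..n}) * (\<integral>x. g x \<partial>D)\<bar> \<le> \<rho> + real (card {1..n}) * \<kappa> / real m \<and>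
             M - A * (\<rho> + real (card {1..n}) * \<kappa> / real m) < w * \<bar>(\<Sum>i = 1..n. g (z (i, J i))) - (\<Sum>i = 1..n. \<Sum>j<m. g (z (i, j))) / real m\<bar>})
          \<le> q * real m ^ card {1..n}"
        unfolding T_def q_def \<rho>'_def by simp
    next
      show "g \<in> borel_measurable D \<and> 0 \<le> g x \<and> g x \<le> \<kappa> \<and> 0 < w \<and> w \<le> A" if "(w, g) \<in> G n" for w g x
        using G[OF that] F[of g] measurable_cong_sets[OF D(2) refl, of borel] by auto
      show "real (card {1..n}) * \<kappa>\<^sup>2 \<le> real m * \<rho>\<^sup>2"
      proof -
        have "real m * \<rho>\<^sup>2 = real n * real n" using n0 by (simp add: m_def \<rho>_def power_divide eval_nat_numeral)
        then show ?thesis using mult_left_mono[OF n(3), of "real n"] by simp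
      qed
    qed (use n D(1) m0 countG \<kappa> A in \<open>auto simp: \<rho>_def\<close>)
    then have "p n \<le> 2 * q" by (simp add: p_def)
    also have "2 * q = 4 * C * exp (5 * \<nu> * L + (C1 * L - \<tau> * L * (M - A * \<rho>') / 4))"
      by (simp add: q_def exp_add)
    also have "\<dots> \<le> 4 * C * exp (- L)"
    proof -
      have "\<tau> * L * M / 8 \<le> \<tau> * L * (M - A * \<rho>') / 4"
      proof -
        have "\<tau> * L * M / 2 \<le> \<tau> * L * (M - A * \<rho>')"
          using mult_left_mono[of "M / 2" "M - A * \<rho>'" "\<tau> * L"] A\<rho> \<tau>0 n(2) by (simp add: L_def)
        then show ?thesis by linarith
      qed
      moreover have "5 * \<nu> * L + C1 * L + L \<le> \<tau> * L * M / 8"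
      proof -
        have "\<tau> * M = \<tau> + 8 * (5 * \<nu> + C1 + 1)" using \<tau>0 by (simp add: M_def field_simps)
        then have "\<tau> * L * M = L * (\<tau> + 8 * (5 * \<nu> + C1 + 1))" by (metis mult.assoc mult.commute)
        moreover have "L * (8 * (5 * \<nu> + C1 + 1)) \<le> L * (\<tau> + 8 * (5 * \<nu> + C1 + 1))"
          using \<tau>0 n(2) by (intro mult_left_mono) (auto simp: L_def)
        ultimately show ?thesis by (simp add: algebra_simps)
      qed
      ultimately have "5 * \<nu> * L + (C1 * L - \<tau> * L * (M - A * \<rho>') / 4) \<le> - L" by linarith
      then show ?thesis using C by simp
    qed
    also have "\<dots> = 4 * C / real n" using n0 by (simp add: L_def exp_minus divide_inverse)
    finally show ?thesis .
  qed
  have "p \<longlonglongrightarrow> 0"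
  proof (rule tendsto_sandwich[of "\<lambda>_. 0" _ _ "\<lambda>n. 4 * C / real n"])
    show "\<forall>\<^sub>F n in sequentially. p n \<le> 4 * C / real n"
    proof -
      have r: "\<forall>\<^sub>F n in sequentially. x \<le> real n" for x
        using filterlim_real_sequentially unfolding filterlim_at_top by auto
      have "\<forall>\<^sub>F n in sequentially. 1 \<le> ln (real n)"
        using filterlim_compose[OF ln_at_top filterlim_real_sequentially] unfolding filterlim_at_top by auto
      from eventually_conj[OF eventually_ge_at_top[of 2] eventually_conj[OF this
        eventually_conj[OF r[of "\<kappa>\<^sup>2"] eventually_conj[OF r[of "2 * (A * (1 + \<kappa>))"] r[of "16 * (A * \<kappa>)"]]]]]
      show ?thesis by eventually_elim (use bound in auto)
    qed
    show "(\<lambda>n. 4 * C / real n) \<longlonglongrightarrow> 0" by (rule lim_const_over_n)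
  qed (auto simp: p_def)
  then show ?thesis unfolding p_def by blast
qed

section \<open>Regularly varying bandwidths\<close>

lemma dyadic_interval:
  fixes x :: real
  assumes "1 \<le> x"
  obtains k :: nat where "2 ^ k \<le> x" "x < 2 ^ Suc k"
proof -
  define n where "n = (LEAST n. x < 2 ^ n)"
  have n: "x < 2 ^ n" unfolding n_def by (rule LeastI_ex) (rule real_arch_pow, simp)
  then obtain k where k: "n = Suc k" using assms by (cases n) auto
  have "\<not> x < 2 ^ k" by (rule not_less_Least) (use k in \<open>simp add: n_def\<close>)
  then show ?thesis using that[of k] n k by simp
qed

lemma regularly_varying_doubling:
  assumes L: "slowly_varying L" and a: "\<And>t. 0 < t \<Longrightarrow> a t = t powr - \<alpha> * L t"
    and r: "r1 < 2 powr - \<alpha>" "2 powr - \<alpha> < r2"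
  shows "\<exists>T>0. \<forall>t\<ge>T. 0 < a t \<and> r1 * a t \<le> a (2 * t) \<and> a (2 * t) \<le> r2 * a t"
proof -
  obtain A where A: "0 < A" "\<And>t. A < t \<Longrightarrow> 0 < L t"
    and lim: "((\<lambda>t. L (2 * t) / L t) \<longlongrightarrow> 1) at_top"
    using L unfolding slowly_varying_def by (metis zero_less_numeral)
  have "((\<lambda>t. 2 powr - \<alpha> * (L (2 * t) / L t)) \<longlongrightarrow> 2 powr - \<alpha> * 1) at_top"
    by (intro tendsto_mult lim tendsto_const)
  then have "\<forall>\<^sub>F t in at_top. r1 < 2 powr - \<alpha> * (L (2 * t) / L t) \<and> 2 powr - \<alpha> * (L (2 * t) / L t) < r2"
    using r by (intro eventually_conj order_tendstoD) auto
  then obtain T0 where T0: "\<And>t. T0 \<le> t \<Longrightarrow> r1 < 2 powr - \<alpha> * (L (2 * t) / L t) \<and> 2 powr - \<alpha> * (L (2 * t) / L t) < r2"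
    unfolding eventually_at_top_linorder by blast
  define T where "T = max T0 (A + 1)"
  have pos: "0 < a t" if "T \<le> t" for t using that A by (simp add: T_def a)
  have eq: "a (2 * t) = 2 powr - \<alpha> * (L (2 * t) / L t) * a t" if "T \<le> t" for t
    using that A(1) A(2)[of t] by (simp add: T_def a powr_mult)
  have "0 < a t \<and> r1 * a t \<le> a (2 * t) \<and> a (2 * t) \<le> r2 * a t" if t: "T \<le> t" for t
  proof -
    have T0t: "T0 \<le> t" using t by (simp add: T_def)
    show ?thesis
      unfolding eq[OF t] using T0[OF T0t] pos[OF t] by (intro conjI mult_right_mono) auto
  qed
  moreover have "0 < T" using A(1) by (simp add: T_def)
  ultimately show ?thesis by blast
qed

text \<open>
  For monotone functions the doubling ratios alone give power bounds (weak forms of Potter's bounds),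
  so the uniform convergence theorem for slowly varying functions is not needed.
\<close>

lemma regularly_varying_lower:
  assumes L: "slowly_varying L" and a: "\<And>t. 0 < t \<Longrightarrow> a t = t powr - \<alpha> * L t"
    and anti: "antimono_on {0<..} a" and \<alpha>: "\<alpha> < \<alpha>'" "0 < \<alpha>'"
  obtains k T where "0 < k" "0 < T" "\<And>t. T \<le> t \<Longrightarrow> k * t powr - \<alpha>' \<le> a t"
proof -
  have r: "2 powr - \<alpha>' < 2 powr - \<alpha>" "2 powr - \<alpha> < 2 powr - \<alpha> + 1" using \<alpha> by auto
  obtain T where T: "0 < T" "\<And>t. T \<le> t \<Longrightarrow> 0 < a t" "\<And>t. T \<le> t \<Longrightarrow> 2 powr - \<alpha>' * a t \<le> a (2 * t)"
    using regularly_varying_doubling[OF L a r] by blast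
  have pow: "(2 ^ k) powr - \<alpha>' * a T \<le> a (2 ^ k * T)" for k :: nat
  proof (induction k)
    case (Suc k)
    have "(2 ^ Suc k) powr - \<alpha>' * a T = 2 powr - \<alpha>' * ((2 ^ k) powr - \<alpha>' * a T)" by (simp add: powr_mult)
    also have "\<dots> \<le> 2 powr - \<alpha>' * a (2 ^ k * T)" by (intro mult_left_mono Suc) auto
    also have "\<dots> \<le> a (2 * (2 ^ k * T))" using T(1) by (intro T(3)) (simp add: mult_le_cancel_right1)
    finally show ?case by (simp add: mult.assoc)
  qed simp
  show ?thesis
  proof (rule that[of "(2 / T) powr - \<alpha>' * a T" T])
    show "0 < (2 / T) powr - \<alpha>' * a T" using T by simp
    show "0 < T" by fact
    fix t assume t: "T \<le> t"
    obtain k where k: "2 ^ k \<le> t / T" "t / T < 2 ^ Suc k" using dyadic_interval[of "t / T"] t T(1) by auto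
    have "(2 / T) powr - \<alpha>' * a T * t powr - \<alpha>' = (2 * (t / T)) powr - \<alpha>' * a T"
      using T t by (simp add: powr_mult powr_divide)
    also have "\<dots> \<le> (2 ^ Suc k) powr - \<alpha>' * a T"
      using k(1) \<alpha> T(1) T(2)[of T] by (intro mult_right_mono powr_mono2') auto
    also have "\<dots> \<le> a (2 ^ Suc k * T)" by (rule pow)
    also have "\<dots> \<le> a t"
    proof (rule monotone_onD[OF anti])
      show "t \<le> 2 ^ Suc k * T" using k(2) T(1) by (simp add: field_simps)
    qed (use T t in auto)
    finally show "(2 / T) powr - \<alpha>' * a T * t powr - \<alpha>' \<le> a t" .
  qed
qed

lemma regularly_varying_upper:
  assumes L: "slowly_varying L" and a: "\<And>t. 0 < t \<Longrightarrow> a t = t powr - \<alpha> * L t"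
    and anti: "antimono_on {0<..} a" and \<alpha>: "\<alpha>' < \<alpha>" "0 < \<alpha>'"
  obtains k T where "0 < k" "0 < T" "\<And>t. T \<le> t \<Longrightarrow> a t \<le> k * t powr - \<alpha>'"
proof -
  have r: "2 powr - \<alpha> - 1 < 2 powr - \<alpha>" "2 powr - \<alpha> < 2 powr - \<alpha>'" using \<alpha> by auto
  obtain T where T: "0 < T" "\<And>t. T \<le> t \<Longrightarrow> 0 < a t" "\<And>t. T \<le> t \<Longrightarrow> a (2 * t) \<le> 2 powr - \<alpha>' * a t"
    using regularly_varying_doubling[OF L a r] by blast
  have pow: "a (2 ^ k * T) \<le> (2 ^ k) powr - \<alpha>' * a T" for k :: nat
  proof (induction k)
    case (Suc k)
    have "a (2 * (2 ^ k * T)) \<le> 2 powr - \<alpha>' * a (2 ^ k * T)" using T(1) by (intro T(3)) (simp add: mult_le_cancel_right1)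
    also have "\<dots> \<le> 2 powr - \<alpha>' * ((2 ^ k) powr - \<alpha>' * a T)" by (intro mult_left_mono Suc) auto
    also have "\<dots> = (2 ^ Suc k) powr - \<alpha>' * a T" by (simp add: powr_mult)
    finally show ?case by (simp add: mult.assoc)
  qed simp
  show ?thesis
  proof (rule that[of "(1 / (2 * T)) powr - \<alpha>' * a T" T])
    show "0 < (1 / (2 * T)) powr - \<alpha>' * a T" using T by simp
    show "0 < T" by fact
    fix t assume t: "T \<le> t"
    obtain k where k: "2 ^ k \<le> t / T" "t / T < 2 ^ Suc k" using dyadic_interval[of "t / T"] t T(1) by auto
    have "a t \<le> a (2 ^ k * T)"
    proof (rule monotone_onD[OF anti])
      show "2 ^ k * T \<le> t" using k(1) T(1) by (simp add: field_simps)
    qed (use T t in auto)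
    also have "\<dots> \<le> (2 ^ k) powr - \<alpha>' * a T" by (rule pow)
    also have "\<dots> \<le> (t / (2 * T)) powr - \<alpha>' * a T"
      using k(2) \<alpha> T(1) T(2)[of T] t by (intro mult_right_mono powr_mono2') (auto simp: field_simps)
    also have "\<dots> = (1 / (2 * T)) powr - \<alpha>' * a T * t powr - \<alpha>'"
      using T t by (simp add: powr_divide powr_mult)
    finally show "a t \<le> (1 / (2 * T)) powr - \<alpha>' * a T * t powr - \<alpha>'" .
  qed
qed

lemma bandwidth_lower:
  assumes L: "slowly_varying L" and a: "\<And>t. 0 < t \<Longrightarrow> a t = t powr - \<alpha> * L t"
    and anti: "antimono_on {0<..} a" and \<alpha>: "0 < \<alpha>" "\<alpha> < 1"
  obtains c where "0 < c" "\<forall>\<^sub>F t in at_top. t powr c \<le> t * a t"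
proof -
  define \<alpha>' where "\<alpha>' = (\<alpha> + 1) / 2"
  have \<alpha>': "\<alpha> < \<alpha>'" "0 < \<alpha>'" "\<alpha>' < 1" using \<alpha> by (auto simp: \<alpha>'_def)
  obtain k T where k: "0 < k" "0 < T" "\<And>t. T \<le> t \<Longrightarrow> k * t powr - \<alpha>' \<le> a t"
    using regularly_varying_lower[OF L a anti \<alpha>'(1,2)] by blast
  define c where "c = (1 - \<alpha>') / 2"
  have c: "0 < c" "1 - \<alpha>' = c + c" using \<alpha>' by (auto simp: c_def)
  have "\<forall>\<^sub>F t :: real in at_top. 1 / k \<le> t powr c" using c(1) by real_asymp
  then have "\<forall>\<^sub>F t in at_top. t powr c \<le> t * a t"
    using eventually_ge_at_top[of T]
  proof eventually_elim
    case (elim t)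
    have t0: "0 < t" using k(2) elim by simp
    have "1 \<le> k * t powr c" using elim(1) k(1) by (simp add: field_simps)
    then have "t powr c \<le> t powr c * (k * t powr c)" by (simp add: mult_le_cancel_left1)
    also have "\<dots> = k * t powr (1 - \<alpha>')" unfolding c(2) powr_add by simp
    also have "\<dots> = t * (k * t powr - \<alpha>')" using t0 by (simp add: powr_diff powr_minus field_simps)
    also have "\<dots> \<le> t * a t" using k(3)[OF elim(2)] t0 by (intro mult_left_mono) auto
    finally show ?case .
  qed
  then show ?thesis using that c(1) by blast
qed

lemma bandwidth_upper:
  assumes L: "slowly_varying L" and a: "\<And>t. 0 < t \<Longrightarrow> a t = t powr - \<alpha> * L t"
    and anti: "antimono_on {0<..} a" and \<alpha>: "0 < \<alpha>"
  obtains c where "0 < c" "\<forall>\<^sub>F t in at_top. a t \<le> t powr - c"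
proof -
  define c where "c = \<alpha> / 3"
  have c: "c + c < \<alpha>" "0 < c + c" "0 < c" using \<alpha> by (auto simp: c_def)
  obtain k T where k: "0 < k" "0 < T" "\<And>t. T \<le> t \<Longrightarrow> a t \<le> k * t powr - (c + c)"
    using regularly_varying_upper[OF L a anti c(1,2)] by blast
  have "\<forall>\<^sub>F t :: real in at_top. k * t powr - c \<le> 1" using c(3) by real_asymp
  then have "\<forall>\<^sub>F t in at_top. a t \<le> t powr - c"
    using eventually_ge_at_top[of T]
  proof eventually_elim
    case (elim t)
    have "a t \<le> t powr - c * (k * t powr - c)"
      using k(3)[OF elim(2)] by (simp add: powr_add[symmetric] mult_ac)
    also have "\<dots> \<le> t powr - c * 1" by (intro mult_left_mono elim) auto
    finally show ?case by simp
  qed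
  then show ?thesis using that c(3) by blast
qed

lemma mult_abs_ln_mono:
  fixes x y :: real
  assumes "0 < x" "x \<le> y" "y \<le> exp (- 1)"
  shows "x * \<bar>ln x\<bar> \<le> y * \<bar>ln y\<bar>"
proof -
  have y: "ln y \<le> - 1" using assms ln_mono[of y "exp (- 1)"] by simp
  have xy: "ln x \<le> ln y" using assms by simp
  define v where "v = ln (y / x)"
  have v: "ln x = ln y - v" "0 \<le> v" using assms by (auto simp: v_def ln_div)
  have "v \<le> y / x - 1" unfolding v_def using assms by (intro ln_le_minus_one) auto
  then have "x * v \<le> y - x" using assms by (simp add: field_simps)
  moreover have "(y - x) * 1 \<le> (y - x) * - ln y" using y assms by (intro mult_left_mono) auto
  ultimately have "x * (v - ln y) \<le> y * - ln y" by (simp add: algebra_simps)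
  then show ?thesis using v y xy by simp
qed

section \<open>Scaled kernels, their weights and expectations\<close>

text \<open>
  Here \<open>y\<close> and \<open>\<phi>\<close> stand for the values of the weight function and of the density at a point, \<open>N\<close>
  for \<open>n * h\<close>, \<open>l\<close> for \<open>\<bar>ln h\<bar>\<close> and \<open>E\<close> for \<open>n\<close> times the expectation of the scaled kernel. The second
  bound expresses that the density is very small where the weight is large. If \<open>\<beta> < 1 / 2\<close>, then \<open>\<eta> > 0\<close>
  can be achieved with some \<open>\<gamma> < 1\<close>.
\<close>

lemma weight_density_bounds:
  fixes y \<phi> \<beta> \<gamma> \<eta> C1 C2 Cf N l E w :: real
  assumes y: "0 < y" and \<phi>: "0 < \<phi>" "\<phi> \<le> Cf" "\<phi> powr \<beta> * y \<le> C2"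
    and \<beta>: "0 < \<beta>" "2 * \<beta> \<le> \<gamma>" and \<eta>: "\<gamma> / \<beta> = 2 + 2 * \<eta>"
    and E: "E \<le> C1 * N * \<phi> powr \<gamma>" and C1: "0 \<le> C1" and N: "0 < N" and l: "1 \<le> l"
    and w: "w = y / sqrt (N * l)"
  shows "w\<^sup>2 * E \<le> C1 * (C2\<^sup>2 * Cf powr (\<gamma> - 2 * \<beta>)) / l"
    and "E \<le> C1 * C2 powr (\<gamma> / \<beta>) * N powr - \<eta> * w powr - (2 + 2 * \<eta>)"
proof -
  have "2 \<le> \<gamma> / \<beta>" using \<beta> by (simp add: field_simps)
  then have \<eta>0: "0 \<le> \<eta>" unfolding \<eta> by simp
  have C2: "0 < C2" using \<phi> y by (smt (verit) mult_pos_pos powr_gt_zero)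
  have w2: "w\<^sup>2 = y\<^sup>2 / (N * l)" using N l by (simp add: w power_divide)
  have w0: "0 < w" using y N l by (simp add: w)
  have "y\<^sup>2 * \<phi> powr \<gamma> = (\<phi> powr \<beta> * y)\<^sup>2 * \<phi> powr (\<gamma> - 2 * \<beta>)"
  proof -
    have "\<phi> powr \<gamma> = \<phi> powr \<beta> * \<phi> powr \<beta> * \<phi> powr (\<gamma> - 2 * \<beta>)"
      by (simp add: powr_add[symmetric])
    then show ?thesis by (simp add: power2_eq_square)
  qed
  also have "\<dots> \<le> C2\<^sup>2 * Cf powr (\<gamma> - 2 * \<beta>)"
    using \<phi> y \<beta> by (intro mult_mono power_mono powr_mono2) auto
  finally have y\<phi>: "y\<^sup>2 * \<phi> powr \<gamma> \<le> C2\<^sup>2 * Cf powr (\<gamma> - 2 * \<beta>)" .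
  have "w\<^sup>2 * E \<le> y\<^sup>2 / (N * l) * (C1 * N * \<phi> powr \<gamma>)" unfolding w2 using E N l by (intro mult_left_mono) auto
  also have "\<dots> = C1 * (y\<^sup>2 * \<phi> powr \<gamma>) / l" using N by simp
  also have "\<dots> \<le> C1 * (C2\<^sup>2 * Cf powr (\<gamma> - 2 * \<beta>)) / l"
    using y\<phi> C1 l by (intro divide_right_mono mult_left_mono) auto
  finally show "w\<^sup>2 * E \<le> C1 * (C2\<^sup>2 * Cf powr (\<gamma> - 2 * \<beta>)) / l" .
  have "\<phi> powr \<gamma> = (\<phi> powr \<beta>) powr (\<gamma> / \<beta>)" using \<beta> by (simp add: powr_powr)
  also have "\<dots> \<le> (C2 / y) powr (\<gamma> / \<beta>)"
    using \<phi> y \<beta> by (intro powr_mono2) (auto simp: field_simps)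
  also have "\<dots> = C2 powr (\<gamma> / \<beta>) * y powr - (2 + 2 * \<eta>)"
    unfolding \<eta>[symmetric] powr_minus using y C2 by (simp add: powr_divide field_simps)
  also have "y = w * sqrt (N * l)" using N l by (simp add: w)
  also have "(w * sqrt (N * l)) powr - (2 + 2 * \<eta>) = w powr - (2 + 2 * \<eta>) * (N * l) powr - (1 + \<eta>)"
    using w0 N l by (simp add: powr_mult powr_powr powr_half_sqrt[symmetric] algebra_simps)
  also have "(N * l) powr - (1 + \<eta>) \<le> N powr - (1 + \<eta>)"
    using N l \<eta>0 by (intro powr_mono2') (auto simp: mult_le_cancel_left1)
  finally have \<phi>\<gamma>: "\<phi> powr \<gamma> \<le> C2 powr (\<gamma> / \<beta>) * (w powr - (2 + 2 * \<eta>) * N powr - (1 + \<eta>))"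
    using C2 by (simp add: mult_left_mono)
  have "E \<le> C1 * N * (C2 powr (\<gamma> / \<beta>) * (w powr - (2 + 2 * \<eta>) * N powr - (1 + \<eta>)))"
    using E mult_left_mono[OF \<phi>\<gamma>, of "C1 * N"] C1 N by simp
  also have "\<dots> = C1 * C2 powr (\<gamma> / \<beta>) * (N * N powr - (1 + \<eta>)) * w powr - (2 + 2 * \<eta>)" by simp
  also have "N * N powr - (1 + \<eta>) = N powr - \<eta>"
    using N powr_add[of N 1 "- (1 + \<eta>)"] by simp
  finally show "E \<le> C1 * C2 powr (\<gamma> / \<beta>) * N powr - \<eta> * w powr - (2 + 2 * \<eta>)" .
qed

text \<open>
  A large weighted deviation at some function of the class forces a large one at a function of the
  countable subclass, with a rational weight that is at most twice as large. The side conditions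
  involve the function only through its expectation, which passes to pointwise limits by dominated
  convergence. So it does not matter whether the approximating kernels have parameters close to those
  of the limit.
\<close>

lemma countable_approximation:
  fixes F F0 :: "('a \<Rightarrow> real) set"
  assumes D: "prob_space D" and F: "\<And>g x. g \<in> F \<Longrightarrow> g \<in> borel_measurable D \<and> 0 \<le> g x \<and> g x \<le> \<kappa>"
    and F0: "F0 \<subseteq> F"
    and g: "g \<in> F" and approx: "\<And>m. Gs m \<in> F0" "\<And>z. (\<lambda>m. Gs m z) \<longlonglongrightarrow> g z"
    and n: "0 < n" and L: "0 \<le> L" and A: "0 < A1" "2 * A0 \<le> A" "8 * A1 \<le> A"
    and w: "0 < w" "w \<le> A0" "w\<^sup>2 * L * (real n * (\<integral>x. g x \<partial>D)) \<le> A1"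
      "1 / 2 < w * L \<Longrightarrow> real n * (\<integral>x. g x \<partial>D) \<le> A1 * real n powr - c"
    and M: "M < w * \<bar>(\<Sum>i=1..n. g (x i)) - real n * (\<integral>x. g x \<partial>D)\<bar>"
  shows "\<exists>q\<in>\<rat>. \<exists>g'\<in>F0. 0 < q \<and> q \<le> A \<and> q\<^sup>2 * L * (real n * (\<integral>x. g' x \<partial>D)) \<le> A \<and>
    (1 < q * L \<longrightarrow> real n * (\<integral>x. g' x \<partial>D) \<le> A * real n powr - c) \<and>
    M < q * \<bar>(\<Sum>i=1..n. g' (x i)) - real n * (\<integral>x. g' x \<partial>D)\<bar>"
proof -
  interpret D: prob_space D by (rule D)
  obtain q where q: "q \<in> \<rat>" "w < q" "q < 2 * w" using Rats_dense_in_real[of w "2 * w"] w by auto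
  define Eg where "Eg = (\<integral>x. g x \<partial>D)"
  have Eg0: "0 \<le> Eg" unfolding Eg_def using F[OF g] by simp
  have lim: "(\<lambda>m. \<integral>x. Gs m x \<partial>D) \<longlonglongrightarrow> Eg"
    unfolding Eg_def
  proof (rule integral_dominated_convergence[where w = "\<lambda>_. \<kappa>"])
    show "AE x in D. norm (Gs m x) \<le> \<kappa>" for m using F[of "Gs m"] F0 approx(1)[of m] by auto
  qed (use F g F0 approx in auto)
  have lim_n: "(\<lambda>m. real n * (\<integral>x. Gs m x \<partial>D)) \<longlonglongrightarrow> real n * Eg" by (intro tendsto_intros lim)
  have lim2: "(\<lambda>m. q\<^sup>2 * L * (real n * (\<integral>x. Gs m x \<partial>D))) \<longlonglongrightarrow> q\<^sup>2 * L * (real n * Eg)"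
    by (intro tendsto_intros lim)
  have lim3: "(\<lambda>m. q * \<bar>(\<Sum>i=1..n. Gs m (x i)) - real n * (\<integral>x. Gs m x \<partial>D)\<bar>)
      \<longlonglongrightarrow> q * \<bar>(\<Sum>i=1..n. g (x i)) - real n * Eg\<bar>"
    by (intro tendsto_intros lim approx)
  have "q\<^sup>2 * (L * (real n * Eg)) \<le> (2 * w)\<^sup>2 * (L * (real n * Eg))"
    using q w L Eg0 by (intro mult_right_mono power_mono) auto
  also have "\<dots> \<le> 4 * A1" using w(3) by (simp add: Eg_def power2_eq_square mult_ac)
  also have "\<dots> < A" using A by simp
  finally have 2: "q\<^sup>2 * L * (real n * Eg) < A" by (simp add: mult.assoc)
  have "w * \<bar>(\<Sum>i=1..n. g (x i)) - real n * Eg\<bar> \<le> q * \<bar>(\<Sum>i=1..n. g (x i)) - real n * Eg\<bar>"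
    using q by (intro mult_right_mono) auto
  then have 3: "M < q * \<bar>(\<Sum>i=1..n. g (x i)) - real n * Eg\<bar>" using M by (simp add: Eg_def)
  have 4: "\<forall>\<^sub>F m in sequentially. 1 < q * L \<longrightarrow> real n * (\<integral>x. Gs m x \<partial>D) \<le> A * real n powr - c"
  proof (cases "1 < q * L")
    case True
    moreover have "q * L \<le> 2 * w * L" using q L by (intro mult_right_mono) auto
    ultimately have "1 / 2 < w * L" by linarith
    then have "real n * Eg \<le> A1 * real n powr - c" using w(4) by (simp add: Eg_def)
    also have "\<dots> < A * real n powr - c" using A n by (intro mult_strict_right_mono) auto
    finally have "\<forall>\<^sub>F m in sequentially. real n * (\<integral>x. Gs m x \<partial>D) < A * real n powr - c"
      by (rule order_tendstoD(2)[OF lim_n])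
    then show ?thesis by eventually_elim auto
  qed simp
  have "\<forall>\<^sub>F m in sequentially. q\<^sup>2 * L * (real n * (\<integral>x. Gs m x \<partial>D)) < A \<and>
      M < q * \<bar>(\<Sum>i=1..n. Gs m (x i)) - real n * (\<integral>x. Gs m x \<partial>D)\<bar> \<and>
      (1 < q * L \<longrightarrow> real n * (\<integral>x. Gs m x \<partial>D) \<le> A * real n powr - c)"
    by (intro eventually_conj order_tendstoD(2)[OF lim2 2] order_tendstoD(1)[OF lim3 3] 4)
  then obtain m where "q\<^sup>2 * L * (real n * (\<integral>x. Gs m x \<partial>D)) < A \<and>
      M < q * \<bar>(\<Sum>i=1..n. Gs m (x i)) - real n * (\<integral>x. Gs m x \<partial>D)\<bar> \<and>
      (1 < q * L \<longrightarrow> real n * (\<integral>x. Gs m x \<partial>D) \<le> A * real n powr - c)"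
    using eventually_happens'[OF sequentially_bot] by blast
  then show ?thesis using q w A approx(1)[of m]
    by (intro bexI[of _ q] bexI[of _ "Gs m"]) auto
qed

lemma compact_support_bound:
  fixes K :: "real ^ 'd \<Rightarrow> real"
  assumes "compact (closure {x. K x \<noteq> 0})"
  obtains R where "0 < R" "\<And>x. K x \<noteq> 0 \<Longrightarrow> infnorm x \<le> R"
proof -
  have "bounded {x. K x \<noteq> 0}" using assms compact_imp_bounded bounded_subset closure_subset by metis
  then obtain R where R: "0 < R" "\<And>x. K x \<noteq> 0 \<Longrightarrow> norm x \<le> R" unfolding bounded_pos by auto
  show ?thesis
  proof (rule that[of R])
    show "infnorm x \<le> R" if "K x \<noteq> 0" for x using R(2)[OF that] infnorm_le_norm[of x] by linarith
  qed (rule R(1))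
qed

lemma scaled_kernel_support:
  fixes K :: "real ^ 'd \<Rightarrow> real"
  assumes R: "\<And>x. K x \<noteq> 0 \<Longrightarrow> infnorm x \<le> R" and h: "0 < h" and x: "scaled_kernel K h t x \<noteq> 0"
  shows "infnorm (x - t) \<le> R * h powr (1 / real CARD('d))"
proof -
  define s where "s = h powr (1 / real CARD('d))"
  have s: "0 < s" using h by (simp add: s_def)
  have "infnorm ((x - t) /\<^sub>R s) \<le> R" using R x by (simp add: scaled_kernel_def s_def)
  then have "infnorm (x - t) / s \<le> R" using s by (simp add: infnorm_mul divide_inverse mult.commute)
  then show ?thesis using s by (simp add: s_def[symmetric] field_simps)
qed

lemma scaled_kernel_measurable:
  fixes K :: "real ^ 'd \<Rightarrow> real"
  assumes [measurable]: "K \<in> borel_measurable borel"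
  shows "scaled_kernel K h t \<in> borel_measurable borel"
  unfolding scaled_kernel_def by measurable

lemma expectation_scaled_kernel_le:
  fixes K f :: "real ^ 'd \<Rightarrow> real"
  assumes D: "D = density lborel (\<lambda>x. ennreal (f x))" and f: "f \<in> borel_measurable borel" "\<And>x. 0 \<le> f x"
    and K: "K \<in> borel_measurable borel" "\<And>x. 0 \<le> K x \<and> K x \<le> \<kappa>"
    and R: "0 < R" "\<And>x. K x \<noteq> 0 \<Longrightarrow> infnorm x \<le> R" and h: "0 < h"
    and s: "\<And>x. infnorm (x - t) \<le> R * h powr (1 / real CARD('d)) \<Longrightarrow> f x \<le> s"
  shows "(\<integral>x. scaled_kernel K h t x \<partial>D) \<le> \<kappa> * (2 * R) ^ CARD('d) * h * s"
proof -
  define r where "r = R * h powr (1 / real CARD('d))"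
  define B where "B = cbox (t - (\<chi> i. r)) (t + (\<chi> i. r))"
  have r: "0 < r" using R h by (simp add: r_def)
  have B: "x \<in> B" if "infnorm (x - t) \<le> r" for x
  proof -
    have "\<bar>x $ i - t $ i\<bar> \<le> r" for i
      using component_le_infnorm_cart[of "x - t" i] that by simp
    then have "t $ i - r \<le> x $ i \<and> x $ i \<le> t $ i + r" for i by (smt (verit))
    then show ?thesis by (simp add: B_def mem_box_cart)
  qed
  have neB: "B \<noteq> {}" using B[of t] r by (auto simp: infnorm_0)
  have vol: "measure lborel B = (2 * R) ^ CARD('d) * h"
  proof -
    have "measure lborel B = (\<Prod>i\<in>(UNIV :: 'd set). 2 * r)"
      using neB unfolding B_def by (subst content_cbox_cart) auto
    also have "\<dots> = (2 * R) ^ CARD('d) * (h powr (1 / real CARD('d))) ^ CARD('d)"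
      by (simp add: r_def power_mult_distrib)
    also have "(h powr (1 / real CARD('d))) ^ CARD('d) = h"
      using h by (simp add: powr_realpow[symmetric] powr_powr)
    finally show ?thesis .
  qed
  have s0: "0 \<le> s" using s[of t] f(2)[of t] R h by (simp add: infnorm_0) 
  have \<kappa>0: "0 \<le> \<kappa>" using K(2)[of 0] by linarith
  have [measurable]: "scaled_kernel K h t \<in> borel_measurable borel" by (rule scaled_kernel_measurable[OF K(1)])
  note [measurable] = f(1)
  have finB: "emeasure lborel B < \<infinity>" unfolding B_def by (rule emeasure_lborel_cbox_finite)
  have intB: "integrable lborel (\<lambda>x. \<kappa> * s * indicator B x)"
    using finB by (intro integrable_mult_right integrable_real_indicator) (auto simp: B_def)
  have le: "f x *\<^sub>R scaled_kernel K h t x \<le> \<kappa> * s * indicator B x" for x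
  proof (cases "scaled_kernel K h t x = 0")
    case False
    have "infnorm (x - t) \<le> r" unfolding r_def by (rule scaled_kernel_support[OF R(2) h False])
    then have "x \<in> B" "f x \<le> s" using B s by (auto simp: r_def)
    moreover have "scaled_kernel K h t x \<le> \<kappa>" "0 \<le> scaled_kernel K h t x" using K(2) by (auto simp: scaled_kernel_def)
    ultimately show ?thesis using mult_mono[of "f x" s "scaled_kernel K h t x" \<kappa>] f(2)[of x] s0 by (simp add: mult.commute)
  qed (use \<kappa>0 s0 in auto)
  have "(\<integral>x. scaled_kernel K h t x \<partial>D) = (\<integral>x. f x *\<^sub>R scaled_kernel K h t x \<partial>lborel)"
    unfolding D using f(2) by (intro integral_density) auto
  also have "\<dots> \<le> (\<integral>x. \<kappa> * s * indicator B x \<partial>lborel)"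
    by (rule integral_mono'[OF intB le]) (use \<kappa>0 s0 in auto)
  also have "\<dots> = \<kappa> * s * measure lborel B" by (simp add: B_def)
  finally show ?thesis unfolding vol by (simp add: mult_ac)
qed

text \<open>
  Here \<open>H n\<close> is a set of bandwidths for the sample size \<open>n\<close>, and \<open>w\<close> is the weight with which \<open>\<bar>\<Sum>i. g (X i) - E\<bar>\<close> enters the weighted
  deviation for the scaled kernel \<open>g\<close>, where \<open>E\<close> is the expectation of the sum. The bounds for small
  and moderate weights are those required for the empirical process bound (with \<open>1 / 2\<close> instead of \<open>1\<close>,
  to leave room for enlarging the weight); the last one says that the centering is negligible if \<open>w\<close>
  is large.
\<close>

lemma deviation_weights:
  fixes K f \<psi> :: "real ^ 'd \<Rightarrow> real" and H :: "nat \<Rightarrow> real set"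
  assumes D: "D = density lborel (\<lambda>x. ennreal (f x))" and f: "f \<in> borel_measurable borel" "\<And>x. 0 \<le> f x"
    and Cf: "\<And>x. f x \<le> Cf"
    and K: "K \<in> borel_measurable borel" "\<And>x. 0 \<le> K x \<and> K x \<le> \<kappa>" "0 < \<kappa>"
    and R: "0 < R" "\<And>x. K x \<noteq> 0 \<Longrightarrow> infnorm x \<le> R"
    and f\<delta>: "\<And>\<delta>. 0 < \<delta> \<Longrightarrow> \<exists>h0>0. \<exists>c>0. \<forall>x y.
          x \<in> positivity_set f \<longrightarrow> x + y \<in> positivity_set f \<longrightarrow> infnorm y \<le> h0 \<longrightarrow>
          inverse c * f x powr (1 + \<delta>) \<le> f (x + y) \<and> f (x + y) \<le> c * f x powr (1 - \<delta>)"
    and \<psi>: "\<And>t. t \<in> positivity_set f \<Longrightarrow> 0 < \<psi> t"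
    and \<beta>: "0 < \<beta>" "\<beta> < 1 / 2" and f\<psi>: "bdd_above ((\<lambda>t. \<bar>f t powr \<beta> * \<psi> t\<bar>) ` positivity_set f)"
    and H: "0 < ca" "0 < cb"
      "\<forall>\<^sub>F n in sequentially. \<forall>h\<in>H n. real n powr ca \<le> real n * h \<and> h \<le> real n powr - cb"
  shows "\<exists>A c. 0 < A \<and> 0 < c \<and> c \<le> 1 \<and> (\<forall>\<^sub>F n in sequentially. \<forall>h\<in>H n. \<forall>t\<in>positivity_set f.
     let w = \<psi> t / sqrt (real n * h * \<bar>ln h\<bar>); E = real n * (\<integral>x. scaled_kernel K h t x \<partial>D) in
     0 < w \<and> w\<^sup>2 * ln (real n) * E \<le> A \<and> (1 / 2 < w * ln (real n) \<longrightarrow> E \<le> A * real n powr - c) \<and>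
     (1 \<le> w \<longrightarrow> w * E \<le> A))"
proof -
  \<comment> \<open>The exponent \<open>\<gamma>\<close> in \<open>f (t + y) \<le> c0 * f t powr \<gamma>\<close> is chosen such that \<open>2 * \<beta> < \<gamma> < 1\<close>.\<close>
  define \<delta> where "\<delta> = (1 - 2 * \<beta>) / 2"
  define \<gamma> where "\<gamma> = 1 - \<delta>"
  have \<delta>: "0 < \<delta>" "2 * \<beta> < \<gamma>" using \<beta> by (auto simp: \<delta>_def \<gamma>_def field_simps)
  obtain h0 c0 where h0: "0 < h0" "0 < c0"
    "\<And>x y. x \<in> positivity_set f \<Longrightarrow> x + y \<in> positivity_set f \<Longrightarrow> infnorm y \<le> h0 \<Longrightarrow> f (x + y) \<le> c0 * f x powr \<gamma>"
    using f\<delta>[OF \<delta>(1)] unfolding \<gamma>_def by blast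
  obtain C2 where C2: "\<And>t. t \<in> positivity_set f \<Longrightarrow> f t powr \<beta> * \<psi> t \<le> C2"
    using f\<psi> unfolding bdd_above_def by (force simp: abs_le_iff)
  define \<eta> where "\<eta> = \<gamma> / \<beta> / 2 - 1"
  have \<eta>: "\<gamma> / \<beta> = 2 + 2 * \<eta>" "0 < \<eta>" using \<delta> \<beta> by (auto simp: \<eta>_def field_simps)
  define C1 where "C1 = \<kappa> * (2 * R) ^ CARD('d) * c0"
  define C3 where "C3 = C1 * C2 powr (\<gamma> / \<beta>)"
  define C4 where "C4 = C1 * (C2\<^sup>2 * Cf powr (\<gamma> - 2 * \<beta>)) / cb"
  define c where "c = min 1 (ca * \<eta> / 2)"
  define A where "A = C3 + C4 + 1"
  have C1: "0 \<le> C1" using K R h0 by (simp add: C1_def)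
  have C3: "0 \<le> C3" using C1 by (simp add: C3_def)
  have C4: "0 \<le> C4" using C1 H by (simp add: C4_def)
  have A: "0 < A" "C3 \<le> A" "C4 \<le> A" using C3 C4 by (auto simp: A_def)
  have c: "0 < c" "c \<le> 1" "c \<le> ca * \<eta> / 2" using H \<eta> by (auto simp: c_def)
  have d: "0 < 1 / real CARD('d)" by simp
  have e1: "\<forall>\<^sub>F n in sequentially. real n powr - cb \<le> exp (- 1)" using H(2) by real_asymp
  have e2: "\<forall>\<^sub>F n in sequentially. R * (real n powr - cb) powr (1 / real CARD('d)) \<le> h0"
    using H(2) R(1) h0(1) d by real_asymp
  have ca\<eta>: "0 < ca * \<eta> / 2" using H \<eta> by simp
  have e3: "\<forall>\<^sub>F n in sequentially. (2 * ln (real n)) powr (2 + 2 * \<eta>) \<le> real n powr (ca * \<eta> / 2)"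
    using ca\<eta> \<eta>(2) by real_asymp
  have "\<forall>\<^sub>F n in sequentially. \<forall>h\<in>H n. \<forall>t\<in>positivity_set f.
     let w = \<psi> t / sqrt (real n * h * \<bar>ln h\<bar>); E = real n * (\<integral>x. scaled_kernel K h t x \<partial>D) in
     0 < w \<and> w\<^sup>2 * ln (real n) * E \<le> A \<and> (1 / 2 < w * ln (real n) \<longrightarrow> E \<le> A * real n powr - c) \<and>
     (1 \<le> w \<longrightarrow> w * E \<le> A)"
    using H(3) e1 e2 e3 eventually_ge_at_top[of 2]
  proof eventually_elim
    case (elim n)
    have n: "1 < real n" using elim(5) by simp
    define L where "L = ln (real n)"
    have L: "0 < L" using n by (simp add: L_def)
    show ?case
    proof (intro ballI)
      fix h t assume h: "h \<in> H n" and t: "t \<in> positivity_set f"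
      define w where "w = \<psi> t / sqrt (real n * h * \<bar>ln h\<bar>)"
      define E where "E = real n * (\<integral>x. scaled_kernel K h t x \<partial>D)"
      define N where "N = real n * h"
      define l where "l = \<bar>ln h\<bar>"
      have N: "real n powr ca \<le> N" and hn: "h \<le> real n powr - cb" using elim(1) h by (auto simp: N_def)
      have "1 \<le> real n powr ca" using n H(1) by (intro ge_one_powr_ge_zero) auto
      then have N1: "1 \<le> N" using N by simp
      then have h0': "0 < h" using zero_less_mult_pos[of "real n" h] n by (simp add: N_def)
      have "ln h \<le> ln (exp (- 1))" using hn elim(2) h0' by (intro ln_mono) auto
      then have l1: "1 \<le> l" by (simp add: l_def)
      have "ln h \<le> ln (real n powr - cb)" using hn h0' by (intro ln_mono) auto
      then have lL: "cb * L \<le> l" using n by (simp add: l_def L_def ln_powr)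
      have ft: "0 < f t" using t by (simp add: positivity_set_def)
      have "(\<integral>x. scaled_kernel K h t x \<partial>D) \<le> \<kappa> * (2 * R) ^ CARD('d) * h * (c0 * f t powr \<gamma>)"
      proof (rule expectation_scaled_kernel_le[OF D f K(1,2) R h0'])
        fix x assume x: "infnorm (x - t) \<le> R * h powr (1 / real CARD('d))"
        also have "\<dots> \<le> R * (real n powr - cb) powr (1 / real CARD('d))"
          using R hn h0' by (intro mult_left_mono powr_mono2) auto
        also have "\<dots> \<le> h0" by (rule elim(3))
        finally have xt: "infnorm (x - t) \<le> h0" .
        show "f x \<le> c0 * f t powr \<gamma>"
        proof (cases "x \<in> positivity_set f")
          case True
          then show ?thesis using h0(3)[OF t, of "x - t"] xt by simp
        next
          case False
          then have "f x \<le> 0" by (simp add: positivity_set_def)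
          also have "0 \<le> c0 * f t powr \<gamma>" using h0 by simp
          finally show ?thesis .
        qed
      qed
      then have "real n * (\<integral>x. scaled_kernel K h t x \<partial>D) \<le> real n * (\<kappa> * (2 * R) ^ CARD('d) * h * (c0 * f t powr \<gamma>))"
        using n by (intro mult_left_mono) auto
      then have EC: "E \<le> C1 * N * f t powr \<gamma>" by (simp add: E_def C1_def N_def mult_ac)
      have wN: "w = \<psi> t / sqrt (N * l)" by (simp add: w_def N_def l_def)
      have N0: "0 < N" using N1 by simp
      have \<beta>\<gamma>: "2 * \<beta> \<le> \<gamma>" using \<delta> by simp
      note wd = weight_density_bounds[OF \<psi>[OF t] ft Cf C2[OF t] \<beta>(1) \<beta>\<gamma> \<eta>(1) EC C1 N0 l1 wN]
      have w0: "0 < w" using \<psi>[OF t] N0 l1 by (simp add: wN)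
      have E0: "0 \<le> E" using K n by (simp add: E_def scaled_kernel_def)
      have "w\<^sup>2 * L * E = L * (w\<^sup>2 * E)" by simp
      also have "\<dots> \<le> L * (C1 * (C2\<^sup>2 * Cf powr (\<gamma> - 2 * \<beta>)) / l)" using wd(1) L by (intro mult_left_mono) auto
      also have "\<dots> = (cb * L / l) * C4" using H(2) by (simp add: C4_def)
      also have "\<dots> \<le> 1 * C4" using lL l1 C4 by (intro mult_right_mono) auto
      finally have 1: "w\<^sup>2 * L * E \<le> A" using A by simp
      have N\<eta>: "N powr - \<eta> \<le> real n powr - (ca * \<eta>)"
      proof -
        have "N powr - \<eta> \<le> (real n powr ca) powr - \<eta>" using N n \<eta>(2) by (intro powr_mono2') auto
        then show ?thesis by (simp add: powr_powr)
      qed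
      have 2: "E \<le> A * real n powr - c" if wL: "1 / 2 < w * L"
      proof -
        have "w powr - (2 + 2 * \<eta>) \<le> (1 / (2 * L)) powr - (2 + 2 * \<eta>)"
          using wL L \<eta>(2) by (intro powr_mono2') (auto simp: field_simps)
        also have "\<dots> = (2 * L) powr (2 + 2 * \<eta>)"
          unfolding powr_minus using L by (simp add: powr_divide)
        also have "\<dots> \<le> real n powr (ca * \<eta> / 2)" using elim(4) by (simp add: L_def)
        finally have w\<eta>: "w powr - (2 + 2 * \<eta>) \<le> real n powr (ca * \<eta> / 2)" .
        have "E \<le> C3 * N powr - \<eta> * w powr - (2 + 2 * \<eta>)" using wd(2) by (simp add: C3_def)
        also have "\<dots> \<le> C3 * real n powr - (ca * \<eta>) * real n powr (ca * \<eta> / 2)"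
          using N\<eta> w\<eta> C3 by (intro mult_mono) auto
        also have "\<dots> = C3 * real n powr - (ca * \<eta> / 2)" by (simp add: powr_add[symmetric] mult_ac)
        also have "\<dots> \<le> A * real n powr - c" using A c n by (intro mult_mono powr_mono) auto
        finally show ?thesis .
      qed
      have 3: "w * E \<le> A" if w1: "1 \<le> w"
      proof -
        have "N powr - \<eta> \<le> 1" using powr_mono2'[of "- \<eta>" 1 N] N1 \<eta>(2) by simp
        moreover have "w * w powr - (2 + 2 * \<eta>) \<le> 1"
        proof -
          have "w * w powr - (2 + 2 * \<eta>) = w powr - (1 + 2 * \<eta>)"
            using w0 powr_add[of w 1 "- (2 + 2 * \<eta>)"] by simp
          also have "\<dots> \<le> 1 powr - (1 + 2 * \<eta>)" using w1 \<eta>(2) by (intro powr_mono2') auto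
          finally show ?thesis by simp
        qed
        ultimately have "C3 * (N powr - \<eta> * (w * w powr - (2 + 2 * \<eta>))) \<le> C3 * (1 * 1)"
          using C3 w0 by (intro mult_left_mono mult_mono) auto
        moreover have "w * E \<le> w * (C3 * N powr - \<eta> * w powr - (2 + 2 * \<eta>))"
          using wd(2) w0 by (intro mult_left_mono) (auto simp: C3_def)
        ultimately show ?thesis using A by (simp add: mult_ac)
      qed
      show "let w = \<psi> t / sqrt (real n * h * \<bar>ln h\<bar>); E = real n * (\<integral>x. scaled_kernel K h t x \<partial>D) in
         0 < w \<and> w\<^sup>2 * ln (real n) * E \<le> A \<and> (1 / 2 < w * ln (real n) \<longrightarrow> E \<le> A * real n powr - c) \<and>
         (1 \<le> w \<longrightarrow> w * E \<le> A)"
        unfolding Let_def w_def[symmetric] E_def[symmetric] L_def[symmetric]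
        using w0 1 2 3 by blast
    qed
  qed
  then show ?thesis using A c by blast
qed

lemma vanishing_relative_oscillationD:
  assumes "vanishing_relative_oscillation g S" and \<epsilon>: "0 < \<epsilon>"
    and s: "filterlim s (at_right 0) F"
  shows "\<forall>\<^sub>F n in F. \<forall>x y. (x, y) \<in> S (s n) \<longrightarrow> \<bar>g (x + y) / g x - 1\<bar> < \<epsilon>"
proof -
  have "((\<lambda>n. SUP (x, y) \<in> S (s n). ereal \<bar>g (x + y) / g x - 1\<bar>) \<longlongrightarrow> 0) F"
    using assms(1) s unfolding vanishing_relative_oscillation_def by (rule filterlim_compose)
  then have "\<forall>\<^sub>F n in F. (SUP (x, y) \<in> S (s n). ereal \<bar>g (x + y) / g x - 1\<bar>) < ereal \<epsilon>"
    by (rule order_tendstoD(2)) (use \<epsilon> in simp)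
  then show ?thesis
  proof eventually_elim
    case (elim n)
    show ?case
    proof (intro allI impI)
      fix x y assume xy: "(x, y) \<in> S (s n)"
      have "ereal \<bar>g (x + y) / g x - 1\<bar> \<le> (SUP (x, y) \<in> S (s n). ereal \<bar>g (x + y) / g x - 1\<bar>)"
        by (rule SUP_upper2[OF xy]) simp
      then have "ereal \<bar>g (x + y) / g x - 1\<bar> < ereal \<epsilon>" using elim by (rule le_less_trans)
      then show "\<bar>g (x + y) / g x - 1\<bar> < \<epsilon>" by simp
    qed
  qed
qed

text \<open>
  If no observation has weight above \<open>norming a (M * n)\<close>, then the kernel window of a point \<open>t\<close> with
  deviation weight at least \<open>2 * sqrt M\<close> contains no observation: \<open>norming a (M * n)\<close> is at most
  \<open>sqrt M * sqrt (n * h * \<bar>ln h\<bar>)\<close>, and \<open>\<psi>\<close> less than doubles within the window.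
\<close>

lemma no_observation_in_window:
  fixes K f \<psi> :: "real ^ 'd \<Rightarrow> real"
  assumes R: "0 < R" "\<And>x. K x \<noteq> 0 \<Longrightarrow> infnorm x \<le> R"
    and \<psi>: "\<And>t. t \<in> positivity_set f \<Longrightarrow> 0 < \<psi> t"
    and osc: "\<And>r. 0 < r \<Longrightarrow> vanishing_relative_oscillation \<psi> (G_set f \<psi> r)"
    and a: "antimono_on {0<..} a"
    and H: "0 < ca" "0 < cb" "\<forall>\<^sub>F t in at_top. t powr ca \<le> t * a t" "\<forall>\<^sub>F t in at_top. b t \<le> t powr - cb"
    and M: "1 \<le> M"
  shows "\<forall>\<^sub>F n in sequentially. \<forall>h\<in>{a (real n)..b (real n)}. \<forall>t\<in>positivity_set f. \<forall>x\<in>positivity_set f.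
    \<psi> x \<le> norming a (M * real n) \<longrightarrow> scaled_kernel K h t x \<noteq> 0 \<longrightarrow>
    \<psi> t / sqrt (real n * h * \<bar>ln h\<bar>) < 2 * sqrt M"
proof -
  define q where "q = 1 / real CARD('d)"
  have q: "0 < q" by (simp add: q_def)
  define s where "s n = R * (real n powr - cb) powr q" for n
  \<comment> \<open>With this \<open>r\<close>, \<open>s n powr - r\<close> is a multiple of \<open>n ^ 2\<close>, which exceeds all values of \<open>\<psi>\<close> at issue.\<close>
  define r where "r = 2 / (cb * q)"
  have r: "0 < r" "cb * q * r = 2" using H(2) q by (auto simp: r_def)
  have cbq: "0 < cb * q" using H(2) q by simp
  have s_alt: "s n = R * real n powr - (cb * q)" for n by (simp add: s_def powr_powr)
  have slim: "filterlim s (at_right 0) sequentially"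
    unfolding s_alt[abs_def] using R(1) cbq by real_asymp
  have k: "0 < R powr - r" using R by simp
  have e1: "\<forall>\<^sub>F n in sequentially. real n \<le> R powr - r * real n ^ 2"
    using k by real_asymp
  have e2: "\<forall>\<^sub>F n in sequentially. real n powr - cb \<le> exp (- 1)" using H(2) by real_asymp
  have lim: "filterlim (\<lambda>n. M * real n) at_top sequentially" using M by real_asymp
  have e3: "\<forall>\<^sub>F n in sequentially. (M * real n) powr ca \<le> (M * real n) * a (M * real n)"
    using H(3) lim by (rule eventually_compose_filterlim)
  have e4: "\<forall>\<^sub>F n in sequentially. real n powr ca \<le> real n * a (real n)"
    using H(3) filterlim_real_sequentially by (rule eventually_compose_filterlim)
  have e5: "\<forall>\<^sub>F n in sequentially. b (real n) \<le> real n powr - cb"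
    using H(4) filterlim_real_sequentially by (rule eventually_compose_filterlim)
  have e6: "\<forall>\<^sub>F n in sequentially. M \<le> real n" by real_asymp
  show ?thesis
    using vanishing_relative_oscillationD[OF osc[OF r(1)] zero_less_one slim] e1 e2 e3 e4 e5 e6
      eventually_ge_at_top[of 1]
  proof eventually_elim
    case (elim n)
    have n: "1 \<le> real n" using elim(8) by simp
    show ?case
    proof (intro ballI impI)
      fix h t x assume h: "h \<in> {a (real n)..b (real n)}" and t: "t \<in> positivity_set f"
        and x: "x \<in> positivity_set f" and \<psi>x: "\<psi> x \<le> norming a (M * real n)"
        and Kx: "scaled_kernel K h t x \<noteq> 0"
      have an: "0 < a (real n)"
      proof -
        have "0 < real n * a (real n)" using elim(5) n by (smt (verit) powr_gt_zero)
        then show ?thesis using zero_less_mult_pos[of "real n" "a (real n)"] n by simp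
      qed
      have aM: "0 < a (M * real n)"
      proof -
        have "0 < (M * real n) * a (M * real n)" using elim(4) n M by (smt (verit) powr_gt_zero mult_pos_pos)
        then show ?thesis using zero_less_mult_pos[of "M * real n" "a (M * real n)"] n M by simp
      qed
      have h0: "0 < h" using an h by simp
      have hn: "h \<le> real n powr - cb" using elim(6) h by simp
      have he: "h \<le> exp (- 1)" using hn elim(3) by simp
      define u where "u = real n * (h * \<bar>ln h\<bar>)"
      have "ln h \<le> ln (exp (- 1))" using h0 he by (intro ln_mono) auto
      then have "0 < \<bar>ln h\<bar>" by simp
      then have u0: "0 < u" unfolding u_def using n h0 by (intro mult_pos_pos) linarith+
      have "a (M * real n) \<le> a (real n)"
        by (rule monotone_onD[OF a]) (use n M in \<open>auto simp: mult_le_cancel_right1\<close>)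
      then have "a (M * real n) * \<bar>ln (a (M * real n))\<bar> \<le> h * \<bar>ln h\<bar>"
        using h he aM by (intro mult_abs_ln_mono) auto
      then have "M * real n * (a (M * real n) * \<bar>ln (a (M * real n))\<bar>) \<le> M * real n * (h * \<bar>ln h\<bar>)"
        using M n by (intro mult_left_mono) auto
      then have "norming a (M * real n) \<le> sqrt (M * u)"
        unfolding norming_def u_def by (intro real_sqrt_le_mono) (simp add: mult_ac)
      then have \<psi>u: "\<psi> x \<le> sqrt M * sqrt u" using \<psi>x by (simp add: real_sqrt_mult)
      have "h * \<bar>ln h\<bar> \<le> exp (- 1) * \<bar>ln (exp (- 1 :: real))\<bar>" using h0 he by (intro mult_abs_ln_mono) auto
      then have "h * \<bar>ln h\<bar> \<le> 1" by simp (smt (verit) exp_le_one_iff)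
      then have "u \<le> real n" using mult_left_mono[of "h * \<bar>ln h\<bar>" 1 "real n"] by (simp add: u_def)
      then have "M * u \<le> real n * real n" using elim(7) u0 by (intro mult_mono) auto
      then have "sqrt (M * u) \<le> real n" by (intro real_le_lsqrt) (auto simp: power2_eq_square)
      then have "\<psi> x \<le> real n" using \<psi>u by (simp add: real_sqrt_mult)
      also have "\<dots> \<le> R powr - r * real n ^ 2" by (rule elim(2))
      also have "\<dots> = s n powr - r"
      proof -
        have "s n powr - r = R powr - r * real n powr (cb * q * r)"
          using R n by (simp add: s_alt powr_mult powr_powr)
        then show ?thesis unfolding r(2) using n by simp
      qed
      finally have \<psi>s: "\<psi> x \<le> s n powr - r" .
      have "infnorm (t - x) = infnorm (x - t)" by (rule infnorm_sub)
      also have "\<dots> \<le> R * h powr q" unfolding q_def by (rule scaled_kernel_support[OF R(2) h0 Kx])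
      also have "\<dots> \<le> s n" unfolding s_def using R hn h0 q by (intro mult_left_mono powr_mono2) auto
      finally have "(x, t - x) \<in> G_set f \<psi> r (s n)" using x t \<psi>s by (simp add: G_set_def)
      then have "\<bar>\<psi> t / \<psi> x - 1\<bar> < 1" using elim(1)[rule_format, of x "t - x"] by simp
      then have "\<psi> t < 2 * \<psi> x" using \<psi>[OF x] by (simp add: field_simps abs_less_iff)
      also have "\<dots> \<le> 2 * (sqrt M * sqrt u)" using \<psi>u by simp
      finally have "\<psi> t / sqrt u < 2 * sqrt M" using u0 by (simp add: field_simps)
      then show "\<psi> t / sqrt (real n * h * \<bar>ln h\<bar>) < 2 * sqrt M" by (simp add: u_def mult.assoc)
    qed
  qed
qed

section \<open>Stochastic boundedness of the weighted deviation\<close>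

lemma exceedance_measurable:
  fixes G :: "(real \<times> ('a \<Rightarrow> real)) set"
  assumes G: "countable G" and g: "\<And>w g. (w, g) \<in> G \<Longrightarrow> g \<in> borel_measurable D"
  shows "{x \<in> space (PiM I (\<lambda>_. D)). \<exists>(w, g)\<in>G. M < w * \<bar>(\<Sum>i\<in>I. g (x i)) - \<mu> g\<bar>}
    \<in> sets (PiM I (\<lambda>_. D))"
proof -
  have "{x \<in> space (PiM I (\<lambda>_. D)). \<exists>(w, g)\<in>G. M < w * \<bar>(\<Sum>i\<in>I. g (x i)) - \<mu> g\<bar>}
    = (\<Union>p\<in>G. {x \<in> space (PiM I (\<lambda>_. D)). M < fst p * \<bar>(\<Sum>i\<in>I. snd p (x i)) - \<mu> (snd p)\<bar>})"
    unfolding case_prod_beta by blast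
  also have "\<dots> \<in> sets (PiM I (\<lambda>_. D))"
  proof (rule sets.countable_UN'[OF G], rule image_subsetI)
    fix p assume "p \<in> G"
    then have "snd p \<in> borel_measurable D" using g[of "fst p" "snd p"] by simp
    then have [measurable]: "(\<lambda>x. \<Sum>i\<in>I. snd p (x i)) \<in> borel_measurable (PiM I (\<lambda>_. D))"
      by (auto intro!: borel_measurable_sum measurable_compose[OF measurable_component_singleton])
    show "{x \<in> space (PiM I (\<lambda>_. D)). M < fst p * \<bar>(\<Sum>i\<in>I. snd p (x i)) - \<mu> (snd p)\<bar>} \<in> sets (PiM I (\<lambda>_. D))"
      by measurable
  qed
  finally show ?thesis .
qed

lemma weighted_deviation_gtD:
  assumes B: "ereal B < weighted_deviation P X f K \<psi> a b n \<omega>" and ne: "positivity_set f \<noteq> {}"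
    and h: "\<And>h. h \<in> {a (real n)..b (real n)} \<Longrightarrow> 0 < h"
  shows "\<exists>h\<in>{a (real n)..b (real n)}. \<exists>t\<in>positivity_set f. B < sqrt (real n * h / \<bar>ln h\<bar>) *
    \<bar>\<psi> t * (kernel_estimator K X n h t \<omega> - (\<integral>\<omega>'. kernel_estimator K X n h t \<omega>' \<partial>P))\<bar>"
proof -
  define u where "u h t = \<bar>\<psi> t * (kernel_estimator K X n h t \<omega> - (\<integral>\<omega>'. kernel_estimator K X n h t \<omega>' \<partial>P))\<bar>" for h t
  obtain h where h: "h \<in> {a (real n)..b (real n)}"
    "ereal B < ereal (sqrt (real n * h / \<bar>ln h\<bar>)) * (SUP t \<in> positivity_set f. ereal (u h t))" "0 < h"
    using B h unfolding weighted_deviation_def u_def less_SUP_iff by blast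
  have "0 \<le> ereal (sqrt (real n * h / \<bar>ln h\<bar>))" using h(3) by simp
  then have "ereal B < (SUP t \<in> positivity_set f. ereal (sqrt (real n * h / \<bar>ln h\<bar>)) * ereal (u h t))"
    using h(2) Sup_ereal_mult_left'[OF ne] by simp
  then obtain t where "t \<in> positivity_set f" "ereal B < ereal (sqrt (real n * h / \<bar>ln h\<bar>)) * ereal (u h t)"
    unfolding less_SUP_iff by blast
  then show ?thesis using h(1) unfolding u_def by auto
qed

lemma kernel_deviation_eq:
  fixes K :: "real ^ 'd \<Rightarrow> real"
  assumes P: "prob_space P" and X: "\<And>i. X i \<in> measurable P borel" "\<And>i. distr P borel (X i) = D"
    and K: "K \<in> borel_measurable borel" "\<And>x. 0 \<le> K x \<and> K x \<le> \<kappa>"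
    and n: "0 < n" and h: "0 < h" and y: "0 < y"
  shows "sqrt (real n * h / \<bar>ln h\<bar>) *
      \<bar>y * (kernel_estimator K X n h t \<omega> - (\<integral>\<omega>'. kernel_estimator K X n h t \<omega>' \<partial>P))\<bar>
    = y / sqrt (real n * h * \<bar>ln h\<bar>) *
      \<bar>(\<Sum>i=1..n. scaled_kernel K h t (X i \<omega>)) - real n * (\<integral>x. scaled_kernel K h t x \<partial>D)\<bar>"
proof -
  interpret prob_space P by (rule P)
  define g where "g = scaled_kernel K h t"
  define N where "N = real n * h"
  have N: "0 < N" using n h by (simp add: N_def)
  have g: "g \<in> borel_measurable borel" "\<And>x. 0 \<le> g x \<and> g x \<le> \<kappa>"
    using scaled_kernel_measurable[OF K(1)] K(2) by (auto simp: g_def scaled_kernel_def)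
  have int: "integrable P (\<lambda>\<omega>. g (X i \<omega>))" for i
    by (rule integrable_const_bound[of _ \<kappa>]) (use g X measurable_compose[OF X(1) g(1)] in auto)
  have "(\<integral>\<omega>'. g (X i \<omega>') \<partial>P) = (\<integral>x. g x \<partial>D)" for i
    using integral_distr[OF X(1)[of i] g(1)] by (simp add: X(2))
  then have mean: "(\<integral>\<omega>'. kernel_estimator K X n h t \<omega>' \<partial>P) = 1 / N * (real n * (\<integral>x. g x \<partial>D))"
    unfolding kernel_estimator_def g_def[symmetric] N_def[symmetric] using int by simp
  have "sqrt (N / l) * \<bar>y * (1 / N * p - 1 / N * q)\<bar> = y / sqrt (N * l) * \<bar>p - q\<bar>" for p q l :: real
  proof -
    have "\<bar>y * (1 / N * p - 1 / N * q)\<bar> = y * \<bar>p - q\<bar> / N"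
      using N y by (simp add: abs_mult right_diff_distrib[symmetric] diff_divide_distrib[symmetric])
    moreover have "sqrt (N / l) / N = 1 / sqrt (N * l)"
    proof -
      have "sqrt (N / l) / N = (sqrt N / N) / sqrt l" by (simp add: real_sqrt_divide)
      also have "sqrt N / N = inverse (sqrt N)" using N by (simp add: sqrt_divide_self_eq)
      finally show ?thesis by (simp add: real_sqrt_mult divide_inverse)
    qed
    ultimately show ?thesis by (metis (no_types, opaque_lifting) mult.commute mult.left_commute times_divide_eq_right mult_1)
  qed
  from this[of _ "\<Sum>i=1..n. g (X i \<omega>)" "real n * (\<integral>x. g x \<partial>D)"] show ?thesis
    unfolding mean unfolding kernel_estimator_def g_def[symmetric] N_def[symmetric] .
qed

lemma iid_sample_distr:
  assumes P: "prob_space P" and ind: "prob_space.indep_vars P (\<lambda>_. N) X UNIV"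
    and X: "\<And>i. X i \<in> measurable P N" "\<And>i. distr P N (X i) = D" and I: "I \<noteq> {}"
  shows "distr P (PiM I (\<lambda>_. D)) (\<lambda>\<omega>. \<lambda>i\<in>I. X i \<omega>) = PiM I (\<lambda>_. D)"
    and "(\<lambda>\<omega>. \<lambda>i\<in>I. X i \<omega>) \<in> measurable P (PiM I (\<lambda>_. D))"
proof -
  interpret prob_space P by (rule P)
  have "sets D = sets N" using X(2) by (metis sets_distr)
  then have s: "sets (PiM I (\<lambda>_. N)) = sets (PiM I (\<lambda>_. D))" by (intro sets_PiM_cong) auto
  have "distr P (PiM I (\<lambda>_. N)) (\<lambda>\<omega>. \<lambda>i\<in>I. X i \<omega>) = PiM I (\<lambda>i. distr P N (X i))"
    using indep_vars_iff_distr_eq_PiM'[OF I, of X "\<lambda>_. N"] indep_vars_subset[OF ind, of I] X(1) by simp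
  moreover have "distr P (PiM I (\<lambda>_. N)) (\<lambda>\<omega>. \<lambda>i\<in>I. X i \<omega>) = distr P (PiM I (\<lambda>_. D)) (\<lambda>\<omega>. \<lambda>i\<in>I. X i \<omega>)"
    by (rule distr_cong) (auto simp: s)
  ultimately show "distr P (PiM I (\<lambda>_. D)) (\<lambda>\<omega>. \<lambda>i\<in>I. X i \<omega>) = PiM I (\<lambda>_. D)" by (simp add: X(2))
  have "(\<lambda>\<omega>. \<lambda>i\<in>I. X i \<omega>) \<in> measurable P (PiM I (\<lambda>_. N))" by (rule measurable_restrict) (rule X(1))
  then show "(\<lambda>\<omega>. \<lambda>i\<in>I. X i \<omega>) \<in> measurable P (PiM I (\<lambda>_. D))"
    using measurable_cong_sets[OF refl s] by blast
qed

theorem theorem1p1: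
  fixes P :: "'w measure"
    and X :: "nat \<Rightarrow> 'w \<Rightarrow> real ^ 'd"
    and f K \<psi> :: "real ^ 'd \<Rightarrow> real"
    and \<kappa> C \<nu> \<beta> \<alpha> \<mu> :: real
    and a b L1 L2 :: "real \<Rightarrow> real"
  \<comment> \<open>i.i.d. data with density \<open>f\<close>; \<open>X 0\<close> is the generic copy and \<open>X 1, X 2, \<dots>\<close> the sample\<close>
  assumes "prob_space P"
    and "prob_space.indep_vars P (\<lambda>_. borel) X UNIV"
    and "\<And>i. distributed P lborel (X i) (\<lambda>x. ennreal (f x))"
    and "\<And>x. 0 \<le> f x"
    and "bounded (range f)"
  \<comment> \<open>kernel\<close>
    and "\<And>x. 0 \<le> K x"
    and "K \<in> borel_measurable borel"
    and "compact (closure {x. K x \<noteq> 0})"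
    and "(\<integral>x. K x \<partial>lborel) = 1"
    and "bdd_above (range (\<lambda>x. \<bar>K x\<bar>))"
    and "\<kappa> = (SUP x. \<bar>K x\<bar>)"
    and "0 < C" and "0 < \<nu>"
    and "\<And>\<epsilon>. 0 < \<epsilon> \<Longrightarrow> \<epsilon> < 1 \<Longrightarrow>
          ereal_of_enat (uniform_covering_number \<kappa> \<epsilon> (kernel_class K)) \<le> ereal (C * \<epsilon> powr (- \<nu>))"
    and "pointwise_measurable (kernel_class K)"
  \<comment> \<open>density\<close>
    and "open (positivity_set f)"
    and "continuous_on (positivity_set f) f"
    and "\<And>\<delta>. 0 < \<delta> \<Longrightarrow> \<exists>h0>0. \<exists>c>0. \<forall>x y.
          x \<in> positivity_set f \<longrightarrow> x + y \<in> positivity_set f \<longrightarrow> infnorm y \<le> h0 \<longrightarrow>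
          inverse c * f x powr (1 + \<delta>) \<le> f (x + y) \<and> f (x + y) \<le> c * f x powr (1 - \<delta>)"
    and "\<And>r. 0 < r \<Longrightarrow> vanishing_relative_oscillation f (F_set f r)"
  \<comment> \<open>weight\<close>
    and "\<And>t. t \<in> positivity_set f \<Longrightarrow> 0 < \<psi> t"
    and "continuous_on (positivity_set f) \<psi>"
    and "\<And>\<delta>. 0 < \<delta> \<Longrightarrow> \<exists>h0>0. \<exists>c>0. \<forall>x y.
          x \<in> positivity_set f \<longrightarrow> x + y \<in> positivity_set f \<longrightarrow> infnorm y \<le> h0 \<longrightarrow>
          inverse c * \<psi> x powr (1 - \<delta>) \<le> \<psi> (x + y) \<and> \<psi> (x + y) \<le> c * \<psi> x powr (1 + \<delta>)"
    and "\<And>r. 0 < r \<Longrightarrow> vanishing_relative_oscillation \<psi> (G_set f \<psi> r)"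
  \<comment> \<open>density and weight jointly\<close>
    and "0 < \<beta>" and "\<beta> < 1 / 2"
    and "bdd_above ((\<lambda>t. \<bar>f t powr \<beta> * \<psi> t\<bar>) ` positivity_set f)"
    and "\<And>r. 0 < r \<Longrightarrow> vanishing_relative_oscillation f (G_set f \<psi> r)"
  \<comment> \<open>bandwidths\<close>
    and "0 < \<mu>" and "\<mu> < \<alpha>" and "\<alpha> < 1"
    and "slowly_varying L1" and "slowly_varying L2"
    and "\<And>t. 0 < t \<Longrightarrow> a t = t powr (- \<alpha>) * L1 t"
    and "\<And>t. 0 < t \<Longrightarrow> b t = t powr (- \<mu>) * L2 t"
    and "antimono_on {0<..} a" and "antimono_on {0<..} b"
    and "strict_mono_on {0<..} (norming a)"
  \<comment> \<open>tail condition\<close>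
    and "Limsup at_top (\<lambda>t::real. ereal (t *
          measure P {\<omega> \<in> space P. X 0 \<omega> \<in> positivity_set f \<and> \<psi> (X 0 \<omega>) > norming a t})) < \<infinity>"
  shows "stochastically_bounded P (weighted_deviation P X f K \<psi> a b)"
proof -
  interpret prob_space P by (rule assms(1))
  define D where "D = distr P borel (X 0)"
  have XlD: "distr P lborel (X i) = density lborel (\<lambda>x. ennreal (f x))" for i
    by (rule distributed_distr_eq_density[OF assms(3)])
  have Xm: "X i \<in> measurable P borel" for i
    using distributed_measurable[OF assms(3)[of i]] by simp
  have Xb: "distr P borel (X i) = density lborel (\<lambda>x. ennreal (f x))" for i
    unfolding XlD[of i, symmetric] by (rule distr_cong) auto
  have Df: "D = density lborel (\<lambda>x. ennreal (f x))" using Xb by (simp add: D_def)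
  have XD: "distr P borel (X i) = D" for i by (simp add: Xb Df)
  have D: "prob_space D" unfolding D_def by (rule prob_space_distr) (rule Xm)
  interpret D: prob_space D by (rule D)
  have sD: "sets D = sets borel" by (simp add: D_def)
  have "(\<lambda>x. enn2real (ennreal (f x))) \<in> borel_measurable lborel"
    using distributed_borel_measurable[OF assms(3)] by (rule measurable_compose) simp
  then have f: "f \<in> borel_measurable borel" using assms(4) by simp
  obtain Cf where Cf: "\<And>x. f x \<le> Cf"
    using assms(5) unfolding bounded_iff by (metis abs_le_iff rangeI real_norm_def)
  have K\<kappa>: "0 \<le> K x \<and> K x \<le> \<kappa>" for x
    using assms(6)[of x] cSUP_upper[OF UNIV_I assms(10), of x] by (simp add: assms(11))
  have \<kappa>: "0 < \<kappa>"
  proof (rule ccontr)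
    assume "\<not> 0 < \<kappa>"
    then have "K = (\<lambda>x. 0)" using K\<kappa> by (intro ext) (metis dual_order.trans eq_iff linorder_not_less)
    then show False using assms(9) by simp
  qed
  obtain R where R: "0 < R" "\<And>x. K x \<noteq> 0 \<Longrightarrow> infnorm x \<le> R" using compact_support_bound[OF assms(8)] by blast
  obtain ca where ca: "0 < ca" "\<forall>\<^sub>F t in at_top. t powr ca \<le> t * a t"
    by (rule bandwidth_lower[OF assms(31) assms(33) assms(35)]) (use assms(28-30) in auto)
  obtain cb where cb: "0 < cb" "\<forall>\<^sub>F t in at_top. b t \<le> t powr - cb"
    by (rule bandwidth_upper[OF assms(32) assms(34) assms(36)]) (use assms(28) in auto)
  have ca_n: "\<forall>\<^sub>F n in sequentially. real n powr ca \<le> real n * a (real n)"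
    using ca(2) filterlim_real_sequentially by (rule eventually_compose_filterlim)
  have cb_n: "\<forall>\<^sub>F n in sequentially. b (real n) \<le> real n powr - cb"
    using cb(2) filterlim_real_sequentially by (rule eventually_compose_filterlim)
  define H where "H n = {a (real n)..b (real n)}" for n
  have Hn: "\<forall>\<^sub>F n in sequentially. \<forall>h\<in>H n. real n powr ca \<le> real n * h \<and> h \<le> real n powr - cb"
    using ca_n cb_n
  proof eventually_elim
    case (elim n)
    have "real n * a (real n) \<le> real n * h" if "h \<in> H n" for h
      using that by (intro mult_left_mono) (auto simp: H_def)
    then show ?case using elim by (fastforce simp: H_def)
  qed
  obtain A1 c where A1: "0 < A1" and c: "0 < c" "c \<le> 1"
    and weights: "\<forall>\<^sub>F n in sequentially. \<forall>h\<in>H n. \<forall>t\<in>positivity_set f.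
     let w = \<psi> t / sqrt (real n * h * \<bar>ln h\<bar>); E = real n * (\<integral>x. scaled_kernel K h t x \<partial>D) in
     0 < w \<and> w\<^sup>2 * ln (real n) * E \<le> A1 \<and> (1 / 2 < w * ln (real n) \<longrightarrow> E \<le> A1 * real n powr - c) \<and>
     (1 \<le> w \<longrightarrow> w * E \<le> A1)"
    using deviation_weights[OF Df f assms(4) Cf assms(7) K\<kappa> \<kappa> R assms(18) assms(20) assms(24-26) ca(1) cb(1) Hn]
    by blast
  define tail where "tail l = measure D {x \<in> positivity_set f. l < \<psi> x}" for l
  have tail_sets: "{x \<in> positivity_set f. l < \<psi> x} \<in> sets borel" for l
  proof -
    have "open (\<psi> -` {l<..} \<inter> positivity_set f)"
      using iffD1[OF continuous_on_open_vimage[OF assms(16)] assms(21), rule_format, of "{l<..}"] by simp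
    moreover have "\<psi> -` {l<..} \<inter> positivity_set f = {x \<in> positivity_set f. l < \<psi> x}" by auto
    ultimately show ?thesis by simp
  qed
  have tail_X: "prob {\<omega> \<in> space P. X i \<omega> \<in> positivity_set f \<and> l < \<psi> (X i \<omega>)} = tail l" for i l
  proof -
    have "tail l = prob (X i -` {x \<in> positivity_set f. l < \<psi> x} \<inter> space P)"
      unfolding tail_def XD[of i, symmetric] by (rule measure_distr[OF Xm]) (rule tail_sets)
    also have "X i -` {x \<in> positivity_set f. l < \<psi> x} \<inter> space P
      = {\<omega> \<in> space P. X i \<omega> \<in> positivity_set f \<and> l < \<psi> (X i \<omega>)}" by auto
    finally show ?thesis by simp
  qed
  have Bf: "positivity_set f \<in> sets borel" using assms(16) by simp
  have null: "emeasure P {\<omega> \<in> space P. X i \<omega> \<notin> positivity_set f} = 0" for i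
  proof -
    have "emeasure D (- positivity_set f) = (\<integral>\<^sup>+x. ennreal (f x) * indicator (- positivity_set f) x \<partial>lborel)"
      unfolding Df using f Bf by (intro emeasure_density) auto
    also have "\<dots> = (\<integral>\<^sup>+x. 0 \<partial>(lborel :: (real ^ 'd) measure))"
    proof (rule nn_integral_cong)
      fix x show "ennreal (f x) * indicator (- positivity_set f) x = 0"
        using assms(4)[of x] by (cases "f x = 0") (auto simp: positivity_set_def indicator_def)
    qed
    finally have "emeasure D (- positivity_set f) = 0" by simp
    moreover have "emeasure D (- positivity_set f) = emeasure P (X i -` (- positivity_set f) \<inter> space P)"
      unfolding XD[of i, symmetric] using Bf by (intro emeasure_distr[OF Xm]) auto
    moreover have "X i -` (- positivity_set f) \<inter> space P = {\<omega> \<in> space P. X i \<omega> \<notin> positivity_set f}" by auto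
    ultimately show ?thesis by simp
  qed
  obtain C0 where C0: "0 \<le> C0" "\<forall>\<^sub>F t in at_top. t * tail (norming a t) \<le> C0"
  proof -
    have "Limsup at_top (\<lambda>t::real. ereal (t * tail (norming a t))) < \<infinity>"
      using assms(38) by (simp add: tail_X)
    then obtain r :: real where "Limsup at_top (\<lambda>t::real. ereal (t * tail (norming a t))) < ereal r"
      using less_PInf_Ex_of_nat by auto
    then have "\<forall>\<^sub>F t in at_top. ereal (t * tail (norming a t)) < ereal r" by (rule Limsup_lessD)
    then have "\<forall>\<^sub>F t in at_top. t * tail (norming a t) \<le> max 0 r" by eventually_elim auto
    then show thesis by (intro that[of "max 0 r"]) auto
  qed
  obtain F0 where F0: "F0 \<subseteq> kernel_class K" "countable F0"
    and F0lim: "\<And>g. g \<in> kernel_class K \<Longrightarrow> \<exists>Gs. (\<forall>m. Gs m \<in> F0) \<and> (\<forall>z. (\<lambda>m. Gs m z) \<longlonglongrightarrow> g z)"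
    using assms(15) unfolding pointwise_measurable_def by blast
  have F: "g \<in> borel_measurable borel \<and> 0 \<le> g x \<and> g x \<le> \<kappa>" if g: "g \<in> kernel_class K" for g x
  proof -
    obtain h t where "g = scaled_kernel K h t" using g unfolding kernel_class_def by blast
    then show ?thesis using scaled_kernel_measurable[OF assms(7)] K\<kappa> by (simp add: scaled_kernel_def)
  qed
  have mD: "g \<in> borel_measurable D" if "g \<in> borel_measurable borel" for g :: "real ^ 'd \<Rightarrow> real"
    using that measurable_cong_sets[OF sD refl] by blast

  define V where "V n B = {\<omega> \<in> space P. weighted_deviation P X f K \<psi> a b n \<omega> > ereal B}" for n B
  have key: "\<exists>B0 p. p \<longlonglongrightarrow> 0 \<and> (\<forall>B\<ge>B0. \<forall>\<^sub>F n in sequentially. outer_measure_of P (V n B) \<le> ennreal (p n + C0 / M))"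
    if M: "1 \<le> M" for M
  proof -
    \<comment> \<open>Deviation weights below \<open>A0\<close> are treated with the empirical process bound, the others with
    the fact that the windows contain no observation.\<close>
    define A0 where "A0 = 2 * sqrt M"
    define A where "A = 8 * A1 + 2 * A0"
    have "1 \<le> sqrt M" using M by simp
    then have A0: "1 \<le> A0" unfolding A0_def by linarith
    have A: "0 < A" "2 * A0 \<le> A" "8 * A1 \<le> A" "1 \<le> A0" using A1 A0 by (auto simp: A_def)
    define G where "G n = {(w, g). w \<in> \<rat> \<and> g \<in> F0 \<and> 0 < w \<and> w \<le> A \<and>
      w\<^sup>2 * ln (real n) * (real n * (\<integral>x. g x \<partial>D)) \<le> A \<and>
      (1 < w * ln (real n) \<longrightarrow> real n * (\<integral>x. g x \<partial>D) \<le> A * real n powr - c)}" for n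
    have countG: "countable (G n)" for n
      by (rule countable_subset[of _ "\<rat> \<times> F0"]) (use F0 countable_rat in \<open>auto simp: G_def\<close>)
    have Gg: "g \<in> borel_measurable D" if "(w, g) \<in> G n" for w g n
    proof -
      have "g \<in> kernel_class K" using that F0(1) by (auto simp: G_def)
      then show ?thesis using F mD by blast
    qed
    define Ex where "Ex Q n = {x \<in> space (PiM {1..n} (\<lambda>_. D)). \<exists>(w, g)\<in>G n.
      Q < w * \<bar>(\<Sum>i=1..n. g (x i)) - real n * (\<integral>x. g x \<partial>D)\<bar>}" for Q :: real and n
    have "\<exists>Q. (\<lambda>n. measure (PiM {1..n} (\<lambda>_. D)) (Ex Q n)) \<longlonglongrightarrow> 0"
      unfolding Ex_def
      by (rule weighted_empirical_process_bound[OF D sD \<kappa> F assms(14) assms(12,13) A(1) c countG])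
         (use subsetD[OF F0(1)] in \<open>auto simp: G_def\<close>)
    then obtain Q where Q: "(\<lambda>n. measure (PiM {1..n} (\<lambda>_. D)) (Ex Q n)) \<longlonglongrightarrow> 0" by blast
    define p where "p n = measure (PiM {1..n} (\<lambda>_. D)) (Ex Q n)" for n
    have tail_n: "\<forall>\<^sub>F n in sequentially. (M * real n) * tail (norming a (M * real n)) \<le> C0"
    proof (rule eventually_compose_filterlim[OF C0(2)])
      show "filterlim (\<lambda>n. M * real n) at_top sequentially" using M by real_asymp
    qed
    have window: "\<forall>\<^sub>F n in sequentially. \<forall>h\<in>{a (real n)..b (real n)}. \<forall>t\<in>positivity_set f.
        \<forall>x\<in>positivity_set f. \<psi> x \<le> norming a (M * real n) \<longrightarrow> scaled_kernel K h t x \<noteq> 0 \<longrightarrow>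
        \<psi> t / sqrt (real n * h * \<bar>ln h\<bar>) < 2 * sqrt M"
      by (rule no_observation_in_window[OF R assms(20) assms(23) assms(35) ca(1) cb(1) ca(2) cb(2) M])
    have "\<forall>\<^sub>F n in sequentially. outer_measure_of P (V n B) \<le> ennreal (p n + C0 / M)" if B: "max Q A1 \<le> B" for B
      using Hn weights tail_n eventually_ge_at_top[of 1] window
    proof eventually_elim
      case (elim n)
      have n: "0 < n" "1 \<le> real n" "{1..n} \<noteq> {}" using elim(4) by auto
      define Smp where "Smp \<omega> = (\<lambda>i\<in>{1..n}. X i \<omega>)" for \<omega>
      note sample = iid_sample_distr[OF assms(1,2) Xm XD n(3)]
      \<comment> \<open>\<open>E1\<close>: large deviation within the countable class; \<open>E2 i\<close>: the weight of observation \<open>i\<close> is too large;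
      \<open>E3 i\<close>: observation \<open>i\<close> lies outside the positivity set.\<close>
      define E1 where "E1 = Smp -` Ex Q n \<inter> space P"
      define E2 where "E2 i = {\<omega> \<in> space P. X i \<omega> \<in> positivity_set f \<and> norming a (M * real n) < \<psi> (X i \<omega>)}" for i
      define E3 where "E3 i = {\<omega> \<in> space P. X i \<omega> \<notin> positivity_set f}" for i
      have Smp: "Smp \<in> measurable P (PiM {1..n} (\<lambda>_. D))" using sample(2) by (simp add: Smp_def[abs_def])
      have Exm: "Ex Q n \<in> sets (PiM {1..n} (\<lambda>_. D))"
        unfolding Ex_def by (rule exceedance_measurable[OF countG Gg])
      have E1m: "E1 \<in> sets P" unfolding E1_def by (rule measurable_sets[OF Smp Exm])
      have E2m: "E2 i \<in> sets P" for i
      proof -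
        have "E2 i = X i -` {x \<in> positivity_set f. norming a (M * real n) < \<psi> x} \<inter> space P" by (auto simp: E2_def)
        then show ?thesis using measurable_sets[OF Xm tail_sets] by simp
      qed
      have E3m: "E3 i \<in> sets P" for i
      proof -
        have "E3 i = X i -` (- positivity_set f) \<inter> space P" by (auto simp: E3_def)
        moreover have "- positivity_set f \<in> sets borel" using Bf by (simp add: borel_comp)
        ultimately show ?thesis using measurable_sets[OF Xm] by simp
      qed
      have PE1: "emeasure P E1 = ennreal (p n)"
      proof -
        have "p n = measure (distr P (PiM {1..n} (\<lambda>_. D)) Smp) (Ex Q n)"
          using sample(1) by (simp add: p_def Smp_def[abs_def])
        also have "\<dots> = prob E1" unfolding E1_def by (rule measure_distr[OF Smp Exm])
        finally show ?thesis by (simp add: emeasure_eq_measure)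
      qed
      have PE2: "emeasure P (\<Union>i\<in>{1..n}. E2 i) \<le> ennreal (C0 / M)"
      proof -
        have "prob (\<Union>i\<in>{1..n}. E2 i) \<le> (\<Sum>i\<in>{1..n}. prob (E2 i))"
          by (rule finite_measure_subadditive_finite) (use E2m in auto)
        also have "\<dots> = real n * tail (norming a (M * real n))" by (simp add: E2_def tail_X)
        also have "\<dots> \<le> C0 / M" using elim(3) M by (simp add: field_simps)
        finally show ?thesis by (simp add: emeasure_eq_measure ennreal_leI)
      qed
      have PE3: "emeasure P (\<Union>i\<in>{1..n}. E3 i) = 0"
      proof -
        have "emeasure P (\<Union>i\<in>{1..n}. E3 i) \<le> (\<Sum>i\<in>{1..n}. emeasure P (E3 i))"
          by (rule emeasure_subadditive_finite) (use E3m in auto)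
        also have "\<dots> = 0" by (simp add: E3_def null)
        finally show ?thesis by simp
      qed
      have incl: "V n B \<subseteq> E1 \<union> (\<Union>i\<in>{1..n}. E2 i) \<union> (\<Union>i\<in>{1..n}. E3 i)"
      proof (rule ccontr)
        assume "\<not> V n B \<subseteq> E1 \<union> (\<Union>i\<in>{1..n}. E2 i) \<union> (\<Union>i\<in>{1..n}. E3 i)"
        then obtain \<omega> where \<omega>: "\<omega> \<in> V n B" "\<omega> \<notin> E1" "\<And>i. i \<in> {1..n} \<Longrightarrow> \<omega> \<notin> E2 i" "\<And>i. i \<in> {1..n} \<Longrightarrow> \<omega> \<notin> E3 i"
          by blast
        have \<omega>P: "\<omega> \<in> space P" using \<omega>(1) by (simp add: V_def)
        have Xpos: "X i \<omega> \<in> positivity_set f" "\<psi> (X i \<omega>) \<le> norming a (M * real n)" if "i \<in> {1..n}" for i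
          using \<omega>(3,4)[OF that] \<omega>P by (auto simp: E2_def E3_def not_less)
        have ne: "positivity_set f \<noteq> {}" using Xpos(1)[of 1] n by auto
        have hpos: "0 < h" if "h \<in> {a (real n)..b (real n)}" for h
        proof -
          have "0 < real n * h" using elim(1) that n by (auto simp: H_def intro: less_le_trans[of _ "real n powr ca"])
          then show ?thesis using zero_less_mult_pos[of "real n" h] n by simp
        qed
        have gt: "ereal B < weighted_deviation P X f K \<psi> a b n \<omega>" using \<omega>(1) by (simp add: V_def)
        obtain h t where h: "h \<in> H n" and t: "t \<in> positivity_set f"
          and dev: "B < sqrt (real n * h / \<bar>ln h\<bar>) *
            \<bar>\<psi> t * (kernel_estimator K X n h t \<omega> - (\<integral>\<omega>'. kernel_estimator K X n h t \<omega>' \<partial>P))\<bar>"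
          using weighted_deviation_gtD[OF gt ne hpos] unfolding H_def by blast
        have h0: "0 < h" using hpos h by (simp add: H_def)
        define w where "w = \<psi> t / sqrt (real n * h * \<bar>ln h\<bar>)"
        define g where "g = scaled_kernel K h t"
        define E where "E = real n * (\<integral>x. g x \<partial>D)"
        have gF: "g \<in> kernel_class K" using h0 unfolding g_def kernel_class_def by blast
        have dev': "B < w * \<bar>(\<Sum>i=1..n. g (X i \<omega>)) - E\<bar>"
          using dev unfolding kernel_deviation_eq[OF assms(1) Xm XD assms(7) K\<kappa> n(1) h0 assms(20)[OF t]]
          by (simp add: w_def g_def E_def)
        have W: "0 < w" "w\<^sup>2 * ln (real n) * E \<le> A1" "1 / 2 < w * ln (real n) \<Longrightarrow> E \<le> A1 * real n powr - c"
          "1 \<le> w \<Longrightarrow> w * E \<le> A1"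
          using elim(2)[rule_format, OF h t] unfolding Let_def w_def[symmetric] g_def[symmetric] E_def[symmetric] by blast+
        have E0: "0 \<le> E" unfolding E_def using F[OF gF] by simp
        show False
        proof (cases "w < A0")
          case False
          have "g (X i \<omega>) = 0" if "i \<in> {1..n}" for i
            using elim(5)[rule_format, OF _ t Xpos[OF that], of h] h False
            by (auto simp: H_def g_def w_def A0_def)
          then have "(\<Sum>i=1..n. g (X i \<omega>)) = 0" by simp
          then have "B < w * E" using dev' E0 by simp
          then show False using W(4) False A(4) B by simp
        next
          case True
          obtain Gs where Gs: "\<And>m. Gs m \<in> F0" "\<And>z. (\<lambda>m. Gs m z) \<longlonglongrightarrow> g z" using F0lim[OF gF] by blast
          have "\<exists>q\<in>\<rat>. \<exists>g'\<in>F0. 0 < q \<and> q \<le> A \<and> q\<^sup>2 * ln (real n) * (real n * (\<integral>x. g' x \<partial>D)) \<le> A \<and>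
            (1 < q * ln (real n) \<longrightarrow> real n * (\<integral>x. g' x \<partial>D) \<le> A * real n powr - c) \<and>
            Q < q * \<bar>(\<Sum>i=1..n. g' (X i \<omega>)) - real n * (\<integral>x. g' x \<partial>D)\<bar>"
          proof (rule countable_approximation[where F = "kernel_class K" and \<kappa> = \<kappa>,
                OF D _ F0(1) gF Gs n(1) _ A1 A(2,3) W(1) _ W(2,3)[unfolded E_def]])
            show "h \<in> borel_measurable D \<and> 0 \<le> h x \<and> h x \<le> \<kappa>" if "h \<in> kernel_class K" for h x
              using F[OF that] mD by blast
            show "w \<le> A0" using True by simp
            show "Q < w * \<bar>(\<Sum>i=1..n. g (X i \<omega>)) - real n * (\<integral>x. g x \<partial>D)\<bar>" using dev' B by (simp add: E_def)
          qed (use n in simp)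
          then obtain q g' where q: "(q, g') \<in> G n"
            "Q < q * \<bar>(\<Sum>i=1..n. g' (X i \<omega>)) - real n * (\<integral>x. g' x \<partial>D)\<bar>"
            unfolding G_def by blast
          have "(\<Sum>i=1..n. g' (Smp \<omega> i)) = (\<Sum>i=1..n. g' (X i \<omega>))" by (rule sum.cong) (auto simp: Smp_def)
          moreover have "Smp \<omega> \<in> space (PiM {1..n} (\<lambda>_. D))" using measurable_space[OF Smp \<omega>P] .
          ultimately have "Smp \<omega> \<in> Ex Q n" using q unfolding Ex_def by (auto intro!: bexI[of _ "(q, g')"])
          then show False using \<omega>(2) \<omega>P by (simp add: E1_def)
        qed
      qed
      have un: "(\<Union>i\<in>{1..n}. E2 i) \<in> sets P" "(\<Union>i\<in>{1..n}. E3 i) \<in> sets P" using E2m E3m by auto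
      have "outer_measure_of P (V n B) \<le> outer_measure_of P (E1 \<union> (\<Union>i\<in>{1..n}. E2 i) \<union> (\<Union>i\<in>{1..n}. E3 i))"
        by (rule outer_measure_of_mono[OF incl])
      also have "\<dots> = emeasure P (E1 \<union> (\<Union>i\<in>{1..n}. E2 i) \<union> (\<Union>i\<in>{1..n}. E3 i))"
        using E1m un by (intro outer_measure_of_eq) auto
      also have "\<dots> \<le> emeasure P (E1 \<union> (\<Union>i\<in>{1..n}. E2 i)) + emeasure P (\<Union>i\<in>{1..n}. E3 i)"
        using E1m un by (intro emeasure_subadditive) auto
      also have "\<dots> \<le> emeasure P E1 + emeasure P (\<Union>i\<in>{1..n}. E2 i)"
        unfolding PE3 using emeasure_subadditive[OF E1m un(1)] by simp
      also have "\<dots> \<le> ennreal (p n) + ennreal (C0 / M)" unfolding PE1 by (intro add_left_mono PE2)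
      also have "\<dots> = ennreal (p n + C0 / M)" using C0 M by (simp add: p_def ennreal_plus)
      finally show ?case .
    qed
    then show ?thesis using Q unfolding p_def[symmetric] by blast
  qed
  show ?thesis
    unfolding stochastically_bounded_def V_def[symmetric]
  proof (rule order_tendstoI)
    fix e :: ennreal assume e: "0 < e"
    obtain r where r: "0 < r" "ennreal r < e"
    proof (cases e)
      case (real s)
      then show thesis using e by (intro that[of "s / 2"]) (auto simp: ennreal_less_iff)
    qed (use that[of 1] in simp)
    define M where "M = max 1 (C0 / r)"
    have M: "1 \<le> M" "C0 / M \<le> r" using r(1) C0(1) by (auto simp: M_def field_simps max_def)
    obtain B0 p where p: "p \<longlonglongrightarrow> 0"
      and B0: "\<And>B. B0 \<le> B \<Longrightarrow> \<forall>\<^sub>F n in sequentially. outer_measure_of P (V n B) \<le> ennreal (p n + C0 / M)"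
      using key[OF M(1)] by blast
    have lim: "(\<lambda>n. ennreal (p n + C0 / M)) \<longlonglongrightarrow> ennreal (0 + C0 / M)"
      by (intro tendsto_ennrealI tendsto_intros p)
    have "limsup (\<lambda>n. outer_measure_of P (V n B)) < e" if "B0 \<le> B" for B
    proof -
      have "limsup (\<lambda>n. outer_measure_of P (V n B)) \<le> limsup (\<lambda>n. ennreal (p n + C0 / M))"
        by (rule Limsup_mono[OF B0[OF that]])
      also have "\<dots> = ennreal (0 + C0 / M)" by (rule lim_imp_Limsup[OF sequentially_bot lim])
      also have "\<dots> \<le> ennreal r" using M(2) by (intro ennreal_leI) simp
      also have "\<dots> < e" by (rule r(2))
      finally show ?thesis .
    qed
    then show "\<forall>\<^sub>F B in at_top. limsup (\<lambda>n. outer_measure_of P (V n B)) < e"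
      by (auto simp: eventually_at_top_linorder)
  qed simp
qed

end
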